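(* Let $f(z)=\sum_{n=1}^\infty z^{n!}$. Let $m$ be a positive integer, $\alpha\in\mathbb{Q}$ satisfying $0<\alpha<1$, and let $\alpha^{1/m}\in\mathbb{C}$ be some determination of the $m$-th root of $\alpha$ (that is, any complex number whose $m$-th power is $\alpha$). Assume that $\alpha$ is not a $p$-th power in $\mathbb{Q}$ for any prime $p\mid m$. Then $f(\alpha^{1/m})\in U_m$. For instance, $f(2^{-1/m})\in U_m$.
   Context: For a complex algebraic number $\beta$, its minimal polynomial $M_\beta(T)\in\mathbb{Z}[T]$ is the polynomial, irreducible in the ring $\mathbb{Z}[T]$, vanishing at $\beta$ (unique up to sign); $|M_\beta|$ denotes the maximum of the absolute values of its coefficients. The degree of $\beta$ is its degree over $\mathbb{Q}$. For a positive integer $m$, $U_m$ is the set of complex transcendental numbers $\gamma$ such that $m$ is the smallest positive integer with the property: for every $w>0$ there exist infinitely many complex algebraic numbers $\beta$ of degree $m$ satisfying $|\gamma-\beta|<|M_\beta|^{-w}$. *)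

theory Defs
  imports "HOL-Analysis.Analysis" "HOL-Computational_Algebra.Computational_Algebra"
begin

text \<open>
  Irreducibility is taken in the ring of integer polynomials, so such a polynomial is primitive.
  It is unique only up to sign; the choice of sign is immaterial for \<open>poly_height\<close>.
  Meaningful for algebraic \<open>\<beta>\<close> only.
\<close>

definition int_min_poly :: "complex \<Rightarrow> int poly" where
  "int_min_poly \<beta> = (SOME M. irreducible M \<and> poly (map_poly of_int M) \<beta> = 0)"

definition poly_height :: "int poly \<Rightarrow> int" where
  "poly_height M = Max ((\<lambda>i. \<bar>coeff M i\<bar>) ` {..degree M})"

text \<open>
  The degree over the rationals is the degree of the monic minimal polynomial with rational
  coefficients.  Meaningful for algebraic \<open>\<beta>\<close> only.
\<close>

definition rat_min_poly :: "complex \<Rightarrow> rat poly" where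
  "rat_min_poly \<beta> =
     (THE P. lead_coeff P = 1 \<and> irreducible P \<and> poly (map_poly of_rat P) \<beta> = 0)"

definition alg_degree :: "complex \<Rightarrow> nat" where
  "alg_degree \<beta> = degree (rat_min_poly \<beta>)"

definition well_approximable :: "nat \<Rightarrow> complex \<Rightarrow> bool" where
  "well_approximable m \<gamma> \<longleftrightarrow>
     (\<forall>w::real. w > 0 \<longrightarrow>
        infinite {\<beta>. algebraic \<beta> \<and> alg_degree \<beta> = m \<and>
                      cmod (\<gamma> - \<beta>) < real_of_int (poly_height (int_min_poly \<beta>)) powr (- w)})"

definition U_class :: "nat \<Rightarrow> complex set" where
  "U_class m =
     {\<gamma>. \<not> algebraic \<gamma> \<and> m > 0 \<and> well_approximable m \<gamma> \<and>
          (\<forall>k. 0 < k \<and> k < m \<longrightarrow> \<not> well_approximable k \<gamma>)}"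

text \<open>The series \<open>z ^ 1! + z ^ 2! + z ^ 3! + \<dots>\<close>; the summation index is shifted by one
  because \<open>suminf\<close> starts at zero.\<close>

definition factorial_series :: "complex \<Rightarrow> complex" where
  "factorial_series z = (\<Sum>n. z ^ fact (Suc n))"

end

theory Submission
  imports Defs
begin

text \<open>
  Let \<open>a ^ m = \<alpha>\<close>, let \<open>\<xi>\<close> be the value of the series at \<open>a\<close> and \<open>\<beta> N\<close> its \<open>N\<close>-th partial sum.
  For \<open>n \<ge> m\<close> the exponent \<open>n!\<close> is a multiple of \<open>m\<close>, so \<open>a ^ n!\<close> is a power of \<open>\<alpha>\<close> and hence
  rational.  Consequently \<open>\<beta> N\<close>, for \<open>N \<ge> m\<close>, is the fixed algebraic number \<open>\<beta> m\<close> plus a rational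
  number whose denominator divides \<open>den ^ N!\<close>, where \<open>den\<close> is the denominator of \<open>\<alpha>\<close>: up to an
  algebraic translation, \<open>\<xi>\<close> is a Liouville number.  The error \<open>\<xi> - \<beta> N\<close> has the size of
  \<open>\<bar>a\<bar> ^ (N + 1)!\<close>, which is eventually smaller than any fixed power of \<open>den ^ -N!\<close>.

  The algebraic core is that \<open>\<beta> m\<close> has degree exactly \<open>m\<close>.  The hypothesis on \<open>\<alpha>\<close> makes
  \<open>X ^ m - \<alpha>\<close> the minimal polynomial of \<open>a\<close> (\<open>degree_root_ge\<close>): the constant coefficient of a
  monic factor of degree \<open>d\<close> has modulus \<open>\<alpha> ^ (d / m)\<close>, and for \<open>0 < d < m\<close> the rationality of this
  number would make \<open>\<alpha>\<close> a \<open>p\<close>-th power.  So \<open>a\<close> may be replaced by the positive root \<open>b\<close>.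
  The value \<open>\<theta> = b ^ 1! + \<dots> + b ^ m!\<close> has only positive summands, so it is strictly larger than
  the real part of the same expression at any other root of \<open>X ^ m - \<alpha>\<close>.  As \<open>\<theta>\<close> is thus taken at
  only one root, a trace argument shows that all \<open>b ^ j\<close> lie, up to a common factor, in the rational
  vector space spanned by the first \<open>d\<close> powers of \<open>\<theta>\<close>, where \<open>d\<close> is the degree of \<open>\<theta>\<close>; hence
  \<open>d \<ge> m\<close> (\<open>degree_ge_of_simple_value\<close>).

  Approximability by numbers of degree \<open>m\<close> then follows by bounding the height of \<open>\<beta> N\<close> by a
  constant times \<open>den ^ (m * N!)\<close>.  For the converse and for transcendence one uses a Liouville
  inequality (\<open>Liouville_ineq\<close>): a nonzero value \<open>Q(\<beta> m)\<close>, with \<open>Q\<close> integral of bounded degree,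
  is in modulus at least a constant times a negative power of the length of \<open>Q\<close>.  After
  translation this bounds below the values \<open>M(\<beta> N)\<close> of integer polynomials \<open>M\<close>.  If \<open>z\<close> has degree \<open>k < m\<close> and \<open>M\<close> is its minimal polynomial,
  then \<open>M(\<beta> N) \<noteq> 0\<close> by comparing degrees, so that \<open>z\<close> cannot be too close to \<open>\<beta> N\<close>.  Choosing
  \<open>N\<close> in terms of the height of \<open>z\<close> (\<open>factorial_gap\<close>) shows that \<open>z\<close> cannot be too close to \<open>\<xi>\<close>.
\<close>

section \<open>Values of integer and rational polynomials at complex numbers\<close>

abbreviation ipoly :: "int poly \<Rightarrow> complex \<Rightarrow> complex" where
  "ipoly P x \<equiv> poly (map_poly of_int P) x"

abbreviation rpoly :: "rat poly \<Rightarrow> complex \<Rightarrow> complex" where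
  "rpoly P x \<equiv> poly (map_poly of_rat P) x"

lemma ipoly_add [simp]: "ipoly (P + Q) x = ipoly P x + ipoly Q x"
proof -
  have "map_poly of_int (P + Q) = (map_poly of_int P + map_poly of_int Q :: complex poly)"
    by (intro poly_eqI) (simp add: coeff_map_poly)
  thus ?thesis by simp
qed

lemma ipoly_smult [simp]: "ipoly (smult c P) x = of_int c * ipoly P x"
  by (simp add: map_poly_smult)

lemma ipoly_pCons [simp]: "ipoly (pCons c P) x = of_int c + x * ipoly P x"
  by (simp add: map_poly_pCons)

lemma ipoly_diff [simp]: "ipoly (P - Q) x = ipoly P x - ipoly Q x"
  using ipoly_add[of "P - Q" Q x] by (simp add: algebra_simps)

lemma ipoly_mult [simp]: "ipoly (P * Q) x = ipoly P x * ipoly Q x"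
  by (induction P) (simp_all add: algebra_simps)

lemma ipoly_power [simp]: "ipoly (P ^ n) x = ipoly P x ^ n"
  by (induction n) simp_all

lemma ipoly_sum [simp]: "ipoly (\<Sum>i\<in>A. f i) x = (\<Sum>i\<in>A. ipoly (f i) x)"
  by (induction A rule: infinite_finite_induct) simp_all

lemma ipoly_altdef: "ipoly P x = (\<Sum>i\<le>degree P. of_int (coeff P i) * x ^ i)"
  by (simp add: poly_altdef degree_map_poly coeff_map_poly)

lemma rpoly_add [simp]: "rpoly (P + Q) x = rpoly P x + rpoly Q x"
proof -
  have "map_poly of_rat (P + Q) = (map_poly of_rat P + map_poly of_rat Q :: complex poly)"
    by (intro poly_eqI) (simp add: coeff_map_poly of_rat_add)
  thus ?thesis by simp
qed

lemma rpoly_smult [simp]: "rpoly (smult c P) x = of_rat c * rpoly P x"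
  by (simp add: map_poly_smult of_rat_mult)

lemma rpoly_pCons [simp]: "rpoly (pCons c P) x = of_rat c + x * rpoly P x"
  by (simp add: map_poly_pCons)

lemma rpoly_diff [simp]: "rpoly (P - Q) x = rpoly P x - rpoly Q x"
  using rpoly_add[of "P - Q" Q x] by (simp add: algebra_simps)

lemma rpoly_mult [simp]: "rpoly (P * Q) x = rpoly P x * rpoly Q x"
  by (induction P) (simp_all add: algebra_simps)

lemma rpoly_power [simp]: "rpoly (P ^ n) x = rpoly P x ^ n"
  by (induction n) simp_all

lemma rpoly_monom [simp]: "rpoly (monom c n) x = of_rat c * x ^ n"
  by (simp add: map_poly_monom poly_monom)

lemma rpoly_sum [simp]: "rpoly (\<Sum>i\<in>A. f i) x = (\<Sum>i\<in>A. rpoly (f i) x)"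
  by (induction A rule: infinite_finite_induct) simp_all

lemma rpoly_pcompose [simp]: "rpoly (pcompose P Q) x = rpoly P (rpoly Q x)"
  by (induction P) (simp_all add: pcompose_pCons)

section \<open>The length of an integer polynomial\<close>

text \<open>
  The length is equivalent to the height for polynomials of bounded degree, but it is
  submultiplicative, which makes it the more convenient measure of size.
\<close>

definition poly_length :: "int poly \<Rightarrow> int" where
  "poly_length P = (\<Sum>i\<le>degree P. \<bar>coeff P i\<bar>)"

lemma poly_length_eq_sum: "degree P \<le> n \<Longrightarrow> poly_length P = (\<Sum>i\<le>n. \<bar>coeff P i\<bar>)"
  unfolding poly_length_def by (intro sum.mono_neutral_left) (auto simp: coeff_eq_0)

lemma poly_length_nonneg [simp]: "poly_length P \<ge> 0"
  by (simp add: poly_length_def sum_nonneg)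

lemma abs_coeff_le_poly_length: "\<bar>coeff P i\<bar> \<le> poly_length P"
  by (cases "i \<le> degree P")
     (auto simp: poly_length_def coeff_eq_0 sum_nonneg intro!: member_le_sum[of i _ "\<lambda>i. \<bar>coeff P i\<bar>"])

lemma poly_length_ge_1: "P \<noteq> 0 \<Longrightarrow> poly_length P \<ge> 1"
  using abs_coeff_le_poly_length[of P "degree P"] leading_coeff_0_iff[of P] by linarith

lemma poly_length_0 [simp]: "poly_length 0 = 0"
  by (simp add: poly_length_def)

lemma poly_length_add: "poly_length (P + Q) \<le> poly_length P + poly_length Q"
proof -
  define n where "n = max (degree P) (degree Q)"
  have "degree (P + Q) \<le> n" "degree P \<le> n" "degree Q \<le> n"
    unfolding n_def by (auto simp: degree_add_le_max)
  thus ?thesis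
    by (simp add: poly_length_eq_sum[of _ n] flip: sum.distrib) (auto intro!: sum_mono)
qed

lemma poly_length_sum: "poly_length (\<Sum>i\<in>A. f i) \<le> (\<Sum>i\<in>A. poly_length (f i))"
proof (induction A rule: infinite_finite_induct)
  case (insert x A)
  thus ?case using poly_length_add[of "f x" "sum f A"] by simp
qed simp_all

lemma poly_length_smult [simp]: "poly_length (smult c P) = \<bar>c\<bar> * poly_length P"
  by (simp add: poly_length_eq_sum[of _ "degree P"] degree_smult_le abs_mult sum_distrib_left)

lemma poly_length_diff: "poly_length (P - Q) \<le> poly_length P + poly_length Q"
  using poly_length_add[of P "smult (-1) Q"] by (simp only: poly_length_smult) simp

lemma poly_length_pCons [simp]: "poly_length (pCons c P) = \<bar>c\<bar> + poly_length P"
proof -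
  have "poly_length (pCons c P) = (\<Sum>i\<le>Suc (degree P). \<bar>coeff (pCons c P) i\<bar>)"
    by (rule poly_length_eq_sum) (rule degree_pCons_le)
  also have "\<dots> = \<bar>c\<bar> + poly_length P"
    by (subst sum.atMost_Suc_shift) (simp add: poly_length_def)
  finally show ?thesis .
qed

lemma poly_length_mult: "poly_length (P * Q) \<le> poly_length P * poly_length Q"
proof (induction P)
  case (pCons c P)
  have "poly_length (pCons c P * Q) \<le> poly_length (smult c Q) + poly_length (pCons 0 (P * Q))"
    by (simp only: mult_pCons_left poly_length_add)
  also have "\<dots> \<le> \<bar>c\<bar> * poly_length Q + poly_length P * poly_length Q"
    using pCons.IH by simp
  finally show ?case by (simp add: algebra_simps)
qed simp

lemma poly_length_power: "poly_length (P ^ n) \<le> poly_length P ^ n"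
proof (induction n)
  case (Suc n)
  have "poly_length (P ^ Suc n) \<le> poly_length P * poly_length (P ^ n)"
    using poly_length_mult[of P "P ^ n"] by simp
  also have "\<dots> \<le> poly_length P * poly_length P ^ n"
    by (intro mult_left_mono Suc) simp
  finally show ?case by simp
qed (simp add: one_pCons)

lemma poly_length_monom [simp]: "poly_length (monom c n) = \<bar>c\<bar>"
  by (induction n) (simp_all add: monom_0 monom_Suc)

lemma norm_ipoly_le:
  assumes "norm x \<le> T" "T \<ge> 1" "degree P \<le> d"
  shows "norm (ipoly P x) \<le> of_int (poly_length P) * T ^ d"
proof -
  have "norm (ipoly P x) \<le> (\<Sum>i\<le>degree P. of_int \<bar>coeff P i\<bar> * T ^ d)"
    unfolding ipoly_altdef
  proof (intro order.trans[OF norm_sum] sum_mono)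
    fix i assume "i \<in> {..degree P}"
    have "norm x ^ i \<le> T ^ i" using assms by (intro power_mono) auto
    also have "\<dots> \<le> T ^ d" using assms \<open>i \<in> _\<close> by (intro power_increasing) auto
    finally show "norm (of_int (coeff P i) * x ^ i) \<le> of_int \<bar>coeff P i\<bar> * T ^ d"
      by (simp add: norm_mult norm_power mult_left_mono)
  qed
  thus ?thesis by (simp add: poly_length_def sum_distrib_right)
qed

lemma norm_power_diff_le:
  fixes x y :: complex
  assumes "norm x \<le> T" "norm y \<le> T" "T \<ge> 1"
  shows "norm (x ^ n - y ^ n) \<le> real n * T ^ n * norm (x - y)"
proof (induction n)
  case (Suc n)
  have "x ^ Suc n - y ^ Suc n = x * (x ^ n - y ^ n) + (x - y) * y ^ n"
    by (simp add: algebra_simps)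
  also have "norm \<dots> \<le> norm x * norm (x ^ n - y ^ n) + norm (x - y) * norm y ^ n"
    using norm_triangle_ineq by (metis norm_mult norm_power)
  also have "\<dots> \<le> T * (real n * T ^ n * norm (x - y)) + norm (x - y) * T ^ Suc n"
  proof (intro add_mono mult_mono Suc)
    have "norm y ^ n \<le> T ^ n" using assms by (intro power_mono) auto
    also have "\<dots> \<le> T ^ Suc n" using assms by (intro power_increasing) auto
    finally show "norm y ^ n \<le> T ^ Suc n" .
  qed (use assms in auto)
  also have "\<dots> = real (Suc n) * T ^ Suc n * norm (x - y)"
    by (simp add: algebra_simps)
  finally show ?case .
qed simp

lemma norm_ipoly_diff_le:
  assumes "norm x \<le> T" "norm y \<le> T" "T \<ge> 1" "degree P \<le> d"
  shows "norm (ipoly P x - ipoly P y) \<le> of_int (poly_length P) * (real d * T ^ d) * norm (x - y)"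
proof -
  have "ipoly P x - ipoly P y = (\<Sum>i\<le>degree P. of_int (coeff P i) * (x ^ i - y ^ i))"
    by (simp add: ipoly_altdef sum_subtractf algebra_simps)
  also have "norm \<dots> \<le> (\<Sum>i\<le>degree P. of_int \<bar>coeff P i\<bar> * (real d * T ^ d * norm (x - y)))"
  proof (intro order.trans[OF norm_sum] sum_mono)
    fix i assume "i \<in> {..degree P}"
    hence "i \<le> d" using assms by auto
    have "norm (x ^ i - y ^ i) \<le> real i * T ^ i * norm (x - y)"
      using assms norm_power_diff_le by blast
    also have "\<dots> \<le> real d * T ^ d * norm (x - y)"
      using assms \<open>i \<le> d\<close> by (intro mult_right_mono mult_mono power_increasing) auto
    finally show "norm (of_int (coeff P i) * (x ^ i - y ^ i)) \<le>
        of_int \<bar>coeff P i\<bar> * (real d * T ^ d * norm (x - y))"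
      by (simp add: norm_mult mult_left_mono)
  qed
  also have "\<dots> = of_int (poly_length P) * (real d * T ^ d) * norm (x - y)"
    by (simp add: poly_length_def sum_distrib_right mult.assoc)
  finally show ?thesis .
qed

section \<open>A Liouville inequality\<close>

text \<open>
  Each step of the division algorithm replaces \<open>G\<close> by a combination of \<open>G\<close> and a shift of \<open>Q\<close> whose
  coefficients are coefficients of \<open>Q\<close> and of \<open>G\<close>; so \<open>n\<close> steps increase the length at most by the
  factor \<open>(3 * poly_length Q) ^ n\<close>.  The factor \<open>3\<close>, in place of \<open>2\<close>, leaves room for the quotient.
\<close>

lemma pseudo_division_poly_length:
  fixes G Q :: "int poly"
  assumes "0 < degree Q" "degree G < degree Q + n"
  shows "\<exists>S R. smult (lead_coeff Q ^ n) G = S * Q + R \<and> degree R < degree Q \<and> degree S \<le> n - 1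
           \<and> poly_length R \<le> (3 * poly_length Q) ^ n * poly_length G \<and> poly_length S \<le> (3 * poly_length Q) ^ n * poly_length G"
  using assms(2)
proof (induction n arbitrary: G)
  case 0
  show ?case using 0 by (intro exI[of _ 0] exI[of _ G]) auto
next
  case (Suc n)
  define q where "q = poly_length Q"
  define l where "l = lead_coeff Q"
  \<comment> \<open>This coefficient may be zero; the step is then merely a multiplication by the leading coefficient.\<close>
  define c where "c = coeff G (degree Q + n)"
  define G' where "G' = smult l G - monom c n * Q"
  have Q0: "Q \<noteq> 0" using assms by auto
  have q1: "q \<ge> 1" unfolding q_def using Q0 by (rule poly_length_ge_1)
  have lq: "\<bar>l\<bar> \<le> q" unfolding l_def q_def by (rule abs_coeff_le_poly_length)
  have cg: "\<bar>c\<bar> \<le> poly_length G" unfolding c_def by (rule abs_coeff_le_poly_length)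
  have "coeff G' i = 0" if "i \<ge> degree Q + n" for i
  proof (cases "i = degree Q + n")
    case True
    thus ?thesis by (simp add: G'_def l_def c_def coeff_monom_mult)
  next
    case False
    hence "coeff G i = 0" "coeff Q (i - n) = 0" using that Suc.prems by (auto intro!: coeff_eq_0)
    thus ?thesis by (simp add: G'_def coeff_monom_mult)
  qed
  hence "degree G' < degree Q + n"
    using assms(1) by (metis add_gr_0 degree_0 leading_coeff_0_iff linorder_not_le)
  from Suc.IH[OF this] obtain S R where SR: "smult (l ^ n) G' = S * Q + R" "degree R < degree Q"
    "degree S \<le> n - 1" "poly_length R \<le> (3 * q) ^ n * poly_length G'" "poly_length S \<le> (3 * q) ^ n * poly_length G'"
    unfolding q_def l_def by blast
  have G': "poly_length G' \<le> 2 * q * poly_length G"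
  proof -
    have "poly_length G' \<le> \<bar>l\<bar> * poly_length G + \<bar>c\<bar> * q"
      unfolding G'_def using poly_length_diff[of "smult l G" "monom c n * Q"] poly_length_mult[of "monom c n" Q]
      by (simp add: q_def)
    also have "\<dots> \<le> q * poly_length G + poly_length G * q"
      using lq cg q1 by (intro add_mono mult_right_mono) auto
    finally show ?thesis by simp
  qed
  have bd: "(3 * q) ^ n * poly_length G' \<le> 2 * 3 ^ n * q ^ Suc n * poly_length G"
  proof -
    have "(3 * q) ^ n * poly_length G' \<le> (3 * q) ^ n * (2 * q * poly_length G)"
      using q1 by (intro mult_left_mono G') auto
    thus ?thesis by (simp add: power_mult_distrib mult_ac)
  qed
  have bd2: "2 * 3 ^ n * q ^ Suc n * poly_length G \<le> (3 * q) ^ Suc n * poly_length G"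
    using q1 by (intro mult_right_mono) (auto simp: power_mult_distrib)
  define S' where "S' = S + monom (l ^ n * c) n"
  have "smult (l ^ Suc n) G = smult (l ^ n) G' + smult (l ^ n) (monom c n) * Q"
    by (simp add: G'_def smult_diff_right mult_ac)
  also have "\<dots> = S' * Q + R"
    by (simp add: SR S'_def algebra_simps smult_monom)
  finally have "smult (l ^ Suc n) G = S' * Q + R" .
  moreover have "degree S' \<le> Suc n - 1"
    unfolding S'_def using SR(3) by (intro degree_add_le) (auto simp: degree_monom_le)
  moreover have "poly_length R \<le> (3 * q) ^ Suc n * poly_length G"
    using SR(4) bd bd2 by linarith
  moreover have "poly_length S' \<le> (3 * q) ^ Suc n * poly_length G"
  proof -
    have "poly_length S' \<le> poly_length S + \<bar>l\<bar> ^ n * \<bar>c\<bar>"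
      unfolding S'_def using poly_length_add[of S "monom (l ^ n * c) n"] by (simp add: abs_mult power_abs)
    also have "\<bar>l\<bar> ^ n * \<bar>c\<bar> \<le> q ^ n * poly_length G"
      using lq cg q1 by (intro mult_mono power_mono) auto
    also have "q ^ n * poly_length G \<le> 3 ^ n * q ^ Suc n * poly_length G"
    proof (intro mult_right_mono)
      have "q ^ n \<le> q ^ Suc n" using q1 by (intro power_increasing) auto
      also have "\<dots> = 1 * q ^ Suc n" by simp
      also have "\<dots> \<le> 3 ^ n * q ^ Suc n" using q1 by (intro mult_right_mono) auto
      finally show "q ^ n \<le> 3 ^ n * q ^ Suc n" .
    qed auto
    finally have "poly_length S' \<le> 2 * 3 ^ n * q ^ Suc n * poly_length G + 3 ^ n * q ^ Suc n * poly_length G"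
      using SR(5) bd by linarith
    also have "\<dots> = (3 * q) ^ Suc n * poly_length G"
      by (simp add: power_mult_distrib algebra_simps)
    finally show ?thesis .
  qed
  ultimately show ?case using SR(2) unfolding l_def q_def by blast
qed

text \<open>
  The polynomial \<open>Q\<close> is \<open>P\<close> translated by \<open>u / s\<close> with its denominators cleared.
\<close>

lemma ipoly_shift:
  fixes P :: "int poly" and s u :: int
  assumes "degree P \<le> d" "s > 0"
  obtains Q where "degree Q \<le> d" "poly_length Q \<le> poly_length P * (s + \<bar>u\<bar>) ^ d"
    "\<And>x. ipoly Q x = of_int s ^ d * ipoly P (x + of_int u / of_int s)"
proof
  define Q where "Q = (\<Sum>i\<le>d. smult (coeff P i * s ^ (d - i)) ([:u, s:] ^ i))"
  show "degree Q \<le> d"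
    unfolding Q_def
  proof (intro degree_sum_le)
    fix i assume "i \<in> {..d}"
    have "degree ([:u, s:] ^ i) \<le> degree [:u, s:] * i" by (rule degree_power_le)
    also have "\<dots> \<le> d" using \<open>i \<in> {..d}\<close> by simp
    finally show "degree (smult (coeff P i * s ^ (d - i)) ([:u, s:] ^ i)) \<le> d"
      using degree_smult_le order.trans by blast
  qed auto
  have "poly_length Q \<le> (\<Sum>i\<le>d. \<bar>coeff P i\<bar> * (s + \<bar>u\<bar>) ^ d)"
    unfolding Q_def
  proof (intro order.trans[OF poly_length_sum] sum_mono)
    fix i assume i: "i \<in> {..d}"
    have "poly_length ([:u, s:] ^ i) \<le> (s + \<bar>u\<bar>) ^ i"
      using poly_length_power[of "[:u, s:]" i] assms(2) by (simp add: add.commute)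
    hence "poly_length (smult (coeff P i * s ^ (d - i)) ([:u, s:] ^ i))
         \<le> \<bar>coeff P i\<bar> * (s ^ (d - i) * (s + \<bar>u\<bar>) ^ i)"
      using assms(2) by (simp add: abs_mult mult_left_mono mult.assoc)
    also have "\<dots> \<le> \<bar>coeff P i\<bar> * ((s + \<bar>u\<bar>) ^ (d - i) * (s + \<bar>u\<bar>) ^ i)"
      using assms(2) by (intro mult_left_mono mult_right_mono power_mono) auto
    also have "\<dots> = \<bar>coeff P i\<bar> * (s + \<bar>u\<bar>) ^ d"
      using i by (simp flip: power_add)
    finally show "poly_length (smult (coeff P i * s ^ (d - i)) ([:u, s:] ^ i))
                    \<le> \<bar>coeff P i\<bar> * (s + \<bar>u\<bar>) ^ d" .
  qed
  thus "poly_length Q \<le> poly_length P * (s + \<bar>u\<bar>) ^ d"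
    by (simp add: poly_length_eq_sum[OF assms(1)] sum_distrib_right)
  fix x :: complex
  have s0: "(of_int s :: complex) \<noteq> 0" using assms(2) by simp
  have "ipoly P (x + of_int u / of_int s) =
      (\<Sum>i\<le>d. of_int (coeff P i) * (x + of_int u / of_int s) ^ i)"
    unfolding ipoly_altdef using assms(1)
    by (intro sum.mono_neutral_left) (auto simp: coeff_eq_0)
  also have "of_int s ^ d * \<dots> =
      (\<Sum>i\<le>d. of_int (coeff P i) * of_int s ^ (d - i) * (of_int s * (x + of_int u / of_int s)) ^ i)"
    unfolding sum_distrib_left
  proof (intro sum.cong refl)
    fix i assume "i \<in> {..d}"
    hence "(of_int s :: complex) ^ d = of_int s ^ (d - i) * of_int s ^ i"
      by (simp flip: power_add)
    thus "of_int s ^ d * (of_int (coeff P i) * (x + of_int u / of_int s) ^ i) =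
       of_int (coeff P i) * of_int s ^ (d - i) * (of_int s * (x + of_int u / of_int s)) ^ i"
      by (simp add: power_mult_distrib mult_ac)
  qed
  also have "of_int s * (x + of_int u / of_int s) = of_int u + x * of_int s"
    using s0 by (simp add: field_simps)
  finally show "ipoly Q x = of_int s ^ d * ipoly P (x + of_int u / of_int s)"
    by (simp add: Q_def)
qed

text \<open>
  The degree of an algebraic number, expressed by integer polynomials of least degree instead
  of minimal polynomials: in this form it can be verified without irreducibility.
\<close>

definition has_degree :: "complex \<Rightarrow> nat \<Rightarrow> bool" where
  "has_degree x n \<longleftrightarrow> (\<exists>P. P \<noteq> 0 \<and> degree P = n \<and> ipoly P x = 0) \<and>
                    (\<forall>P. P \<noteq> 0 \<and> degree P < n \<longrightarrow> ipoly P x \<noteq> 0)"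

lemma has_degreeD: "has_degree x n \<Longrightarrow> P \<noteq> 0 \<Longrightarrow> ipoly P x = 0 \<Longrightarrow> n \<le> degree P"
  unfolding has_degree_def by (meson not_le)

lemma has_degree_pos: "has_degree x n \<Longrightarrow> n > 0"
  unfolding has_degree_def by (auto elim!: degree_eq_zeroE intro!: Nat.gr0I)

text \<open>
  Induction on the degree bound.  Dividing the minimal polynomial \<open>F\<close> of \<open>\<theta>\<close> by \<open>Q\<close> gives
  \<open>S(\<theta>) Q(\<theta>) = - R(\<theta>)\<close> with \<open>R\<close> of smaller degree than \<open>Q\<close>.  Here \<open>S(\<theta>)\<close> is bounded above
  trivially and \<open>R(\<theta>)\<close> is bounded below by induction.
\<close>

lemma Liouville_ineq_below_degree:
  assumes "has_degree \<theta> m" "d < m"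
  shows "\<exists>c>0. \<exists>e. \<forall>Q. Q \<noteq> 0 \<and> degree Q \<le> d \<longrightarrow> c \<le> norm (ipoly Q \<theta>) * of_int (poly_length Q) ^ e"
  using assms(2)
proof (induction d)
  case 0
  have "1 \<le> norm (ipoly Q \<theta>) * of_int (poly_length Q) ^ 0" if "Q \<noteq> 0" "degree Q \<le> 0" for Q
  proof -
    from that obtain a where "Q = [:a:]" by (auto elim: degree_eq_zeroE)
    thus ?thesis using that by (simp add: norm_of_int) 
  qed
  thus ?case by (intro exI[of _ 1] conjI exI[of _ 0]) auto
next
  case (Suc d)
  obtain c e where c: "c > 0" and
    ce: "\<And>Q. Q \<noteq> 0 \<Longrightarrow> degree Q \<le> d \<Longrightarrow> c \<le> norm (ipoly Q \<theta>) * of_int (poly_length Q) ^ e"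
    using Suc.IH Suc.prems by auto
  obtain F where F: "F \<noteq> 0" "degree F = m" "ipoly F \<theta> = 0"
    using assms(1) unfolding has_degree_def by auto
  define T where "T = max 1 (norm \<theta>)"
  define f :: real where "f = of_int (poly_length F)"
  have f1: "f \<ge> 1" unfolding f_def using poly_length_ge_1[OF F(1)] by simp
  define n where "n = m - d"
  have n: "Suc d + n = Suc m" using Suc.prems by (simp add: n_def)
  define K where "K = (3 ^ n * f) ^ Suc e * T ^ m"
  have T1: "T \<ge> 1" by (simp add: T_def)
  have K1: "K \<ge> 1" unfolding K_def using f1 T1
    by (intro mult_ge1_I one_le_power) (auto intro: mult_ge1_I)
  have "c / K \<le> norm (ipoly Q \<theta>) * of_int (poly_length Q) ^ (n * Suc e)" 
    if Q: "Q \<noteq> 0" "degree Q \<le> Suc d" for Q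
  proof -
    define q :: real where "q = of_int (poly_length Q)"
    have q1: "q \<ge> 1" unfolding q_def using poly_length_ge_1[OF Q(1)] by simp
    show ?thesis
    proof (cases "degree Q \<le> d")
      case True
      have "c / K \<le> c" using K1 c by (simp add: field_simps)
      also have "c \<le> norm (ipoly Q \<theta>) * q ^ e" unfolding q_def using True Q ce by blast
      also have "\<dots> \<le> norm (ipoly Q \<theta>) * q ^ (n * Suc e)"
      proof (intro mult_left_mono power_increasing)
        have "1 * e \<le> n * Suc e" using n Suc.prems by (intro mult_mono) auto
        thus "e \<le> n * Suc e" by simp
      qed (use q1 in auto)
      finally show ?thesis by (simp add: q_def)
    next
      case False
      hence k: "degree Q = Suc d" using Q by simp
      obtain S R where SR: "smult (lead_coeff Q ^ n) F = S * Q + R" "degree R < degree Q"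
        "degree S \<le> n - 1" "poly_length R \<le> (3 * poly_length Q) ^ n * poly_length F" "poly_length S \<le> (3 * poly_length Q) ^ n * poly_length F"
        using pseudo_division_poly_length[of Q F n] k n F(2) by auto
      \<comment> \<open>The remainder does not vanish: \<open>Q\<close> and \<open>S\<close> are nonzero of degree less than \<open>m\<close>, so neither
        has the root \<open>\<theta>\<close>.\<close>
      have eq: "ipoly S \<theta> * ipoly Q \<theta> = - ipoly R \<theta>"
        using arg_cong[OF SR(1), of "\<lambda>P. ipoly P \<theta>"] F(3) by (simp add: add_eq_0_iff)
      have Qnz: "ipoly Q \<theta> \<noteq> 0"
        using has_degreeD[OF assms(1) Q(1)] Suc.prems k by auto
      have "S \<noteq> 0"
      proof
        assume "S = 0"
        hence "degree (smult (lead_coeff Q ^ n) F) < degree Q" using SR by simp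
        moreover have "lead_coeff Q ^ n \<noteq> 0" using Q(1) by (metis leading_coeff_0_iff power_not_zero)
        ultimately show False using F k Suc.prems by (simp only: degree_smult_eq) simp
      qed
      hence "ipoly S \<theta> \<noteq> 0"
        using has_degreeD[OF assms(1), of S] SR(3) n Suc.prems by linarith
      hence "R \<noteq> 0" using eq Qnz by auto
      define r where "r = (3 * q) ^ n * f"
      have r: "r = 3 ^ n * f * q ^ n" by (simp add: r_def power_mult_distrib)
      have lR: "of_int (poly_length R) \<le> r"
        using SR(4) unfolding r_def q_def f_def 
        by (metis of_int_le_iff of_int_mult of_int_numeral of_int_power)
      have lS: "of_int (poly_length S) \<le> r"
        using SR(5) unfolding r_def q_def f_def 
        by (metis of_int_le_iff of_int_mult of_int_numeral of_int_power)
      have r0: "r \<ge> 0" using q1 f1 by (simp add: r_def)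
      have nS: "norm (ipoly S \<theta>) \<le> r * T ^ m"
      proof -
        have "norm (ipoly S \<theta>) \<le> of_int (poly_length S) * T ^ m"
          using SR(3) n by (intro norm_ipoly_le) (auto simp: T_def)
        also have "\<dots> \<le> r * T ^ m" using lS T1 by (intro mult_right_mono) auto
        finally show ?thesis .
      qed
      have "c \<le> norm (ipoly R \<theta>) * of_int (poly_length R) ^ e"
        using ce[OF \<open>R \<noteq> 0\<close>] SR(2) k by simp
      also have "\<dots> \<le> norm (ipoly R \<theta>) * r ^ e"
        using lR by (intro mult_left_mono power_mono) auto
      also have "norm (ipoly R \<theta>) = norm (ipoly S \<theta>) * norm (ipoly Q \<theta>)"
        using eq by (metis norm_minus_cancel norm_mult)
      also have "\<dots> * r ^ e \<le> (r * T ^ m * norm (ipoly Q \<theta>)) * r ^ e"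
        using nS r0 by (intro mult_right_mono) auto
      also have "\<dots> = norm (ipoly Q \<theta>) * q ^ (n * Suc e) * K"
        by (simp add: K_def r power_mult_distrib power_add mult_ac flip: power_mult)
      finally show ?thesis using K1 by (simp add: q_def field_simps)
    qed
  qed
  thus ?case using c K1 by (intro exI[of _ "c / K"]) auto
qed

text \<open>
  For larger degree, reduce \<open>Q\<close> modulo the fixed polynomial \<open>F\<close>.
\<close>

lemma Liouville_ineq:
  assumes "has_degree \<theta> m"
  shows "\<exists>c>0. \<exists>e. \<forall>Q. degree Q \<le> D \<and> ipoly Q \<theta> \<noteq> 0 \<longrightarrow>
           c \<le> norm (ipoly Q \<theta>) * of_int (poly_length Q) ^ e"
proof -
  have m: "m > 0" using has_degree_pos assms by blast
  obtain F where F: "F \<noteq> 0" "degree F = m" "ipoly F \<theta> = 0"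
    using assms unfolding has_degree_def by auto
  obtain c e where c: "c > 0" and
    ce: "\<And>Q. Q \<noteq> 0 \<Longrightarrow> degree Q \<le> m - 1 \<Longrightarrow> c \<le> norm (ipoly Q \<theta>) * of_int (poly_length Q) ^ e"
    using Liouville_ineq_below_degree[OF assms, of "m - 1"] m by auto
  define l where "l = lead_coeff F"
  have l: "l \<noteq> 0" using F(1) by (metis l_def leading_coeff_0_iff)
  define n where "n = Suc D"
  define A :: real where "A = of_int ((3 * poly_length F) ^ n)"
  have "1 \<le> (3 * poly_length F) ^ n" using poly_length_ge_1[OF F(1)] by (intro one_le_power) simp
  hence A1: "A \<ge> 1" unfolding A_def by (simp only: of_int_1_le_iff)
  define K where "K = \<bar>of_int l\<bar> ^ n * A ^ e"
  have K: "K > 0" using A1 l by (auto simp: K_def)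
  have "c / K \<le> norm (ipoly Q \<theta>) * of_int (poly_length Q) ^ e"
    if Q: "degree Q \<le> D" "ipoly Q \<theta> \<noteq> 0" for Q
  proof -
    obtain S R where SR: "smult (l ^ n) Q = S * F + R" "degree R < degree F"
        "poly_length R \<le> (3 * poly_length F) ^ n * poly_length Q"
      using pseudo_division_poly_length[of F Q n] F m Q(1) unfolding l_def n_def by auto
    have eq: "of_int l ^ n * ipoly Q \<theta> = ipoly R \<theta>"
      using arg_cong[OF SR(1), of "\<lambda>P. ipoly P \<theta>"] F(3) by simp
    hence "R \<noteq> 0" using Q(2) l by auto
    have lR: "real_of_int (poly_length R) \<le> A * of_int (poly_length Q)"
      using SR(3) unfolding A_def by (metis of_int_le_iff of_int_mult)
    have "c \<le> norm (ipoly R \<theta>) * of_int (poly_length R) ^ e"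
      using ce[OF \<open>R \<noteq> 0\<close>] SR(2) F by simp
    also have "\<dots> \<le> norm (ipoly R \<theta>) * (A * of_int (poly_length Q)) ^ e"
      using lR by (intro mult_left_mono power_mono) auto
    also have "\<dots> = norm (ipoly Q \<theta>) * of_int (poly_length Q) ^ e * K"
      by (simp add: norm_mult norm_power K_def power_mult_distrib mult_ac flip: eq)
    finally show ?thesis using K by (simp add: field_simps)
  qed
  thus ?thesis using c K by (intro exI[of _ "c / K"]) auto
qed

section \<open>Degree and height of algebraic numbers\<close>

lemma algebraic_imp_has_degree:
  assumes "algebraic x"
  obtains n where "has_degree x n"
proof -
  define A where "A = (\<lambda>n. \<exists>P. P \<noteq> 0 \<and> degree P = n \<and> ipoly P x = 0)"
  from assms obtain P where "ipoly P x = 0" "P \<noteq> 0" by (auto elim: algebraicE')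
  hence "A (degree P)" by (auto simp: A_def)
  hence "A (LEAST n. A n)" by (rule LeastI)
  moreover have "\<not>A k" if "k < (LEAST n. A n)" for k using that not_less_Least by blast
  ultimately have "has_degree x (LEAST n. A n)"
    unfolding has_degree_def A_def by blast
  thus ?thesis using that by blast
qed

lemma has_degree_imp_algebraic: "has_degree x n \<Longrightarrow> algebraic x"
  unfolding has_degree_def
  by (auto intro!: algebraicI[of "map_poly of_int _"] simp: coeff_map_poly map_poly_eq_0_iff)

lemma clear_denominators:
  fixes P :: "rat poly"
  obtains c :: int and Q :: "int poly"
  where "c \<noteq> 0" "degree Q = degree P" "\<And>x. ipoly Q x = of_int c * rpoly P x"
proof -
  have "\<exists>(c::int) Q. c \<noteq> 0 \<and> map_poly of_int Q = smult (of_int c) P"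
  proof (induction P)
    case 0
    show ?case by (intro exI[of _ 1] exI[of _ 0]) auto
  next
    case (pCons a P)
    obtain c Q where cQ: "c \<noteq> 0" "map_poly of_int Q = smult (of_int c) P"
      using pCons.IH by auto
    obtain n d :: int where nd: "d > 0" "a = of_int n / of_int d"
      by (metis Fract_of_int_quotient Rat_cases_nonzero Rat_cases)
    have "map_poly of_int (pCons (n * c) (smult d Q)) = smult (of_int (c * d)) (pCons a P)"
      using nd by (simp add: map_poly_pCons map_poly_smult cQ field_simps)
    thus ?case using nd cQ by (metis less_irrefl mult_eq_0_iff)
  qed
  then obtain c Q where cQ: "c \<noteq> 0" "map_poly of_int Q = smult (of_int c) P" by auto
  have "degree Q = degree (map_poly of_int Q :: rat poly)"
    by (simp add: degree_map_poly)
  hence "degree Q = degree P" using cQ by simp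
  moreover have "ipoly Q x = of_int c * rpoly P x" for x
  proof -
    have "ipoly Q x = rpoly (map_poly of_int Q) x"
      by (subst map_poly_map_poly) (auto simp: o_def)
    thus ?thesis using cQ by simp
  qed
  ultimately show ?thesis using that cQ by blast
qed

lemma has_degreeD_rat:
  assumes "has_degree x n" "P \<noteq> 0" "rpoly P x = 0"
  shows "n \<le> degree P"
proof -
  obtain c Q where cQ: "c \<noteq> 0" "degree Q = degree P" "\<And>x. ipoly Q x = of_int c * rpoly P x"
    using clear_denominators by blast
  have "Q \<noteq> 0"
  proof
    assume "Q = 0"
    hence "degree P = 0" using cQ by simp
    then obtain a where "P = [:a:]" by (auto elim: degree_eq_zeroE)
    thus False using assms by simp
  qed
  moreover have "ipoly Q x = 0" using cQ assms by simp
  ultimately show ?thesis using has_degreeD[OF assms(1)] cQ by metis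
qed

lemma has_degree_rem_eq_0:
  assumes "has_degree x n" "ipoly F x = 0" "degree F = n" "ipoly G x = 0"
  obtains l S where "l \<noteq> 0" "smult l G = S * F"
proof -
  have n: "n > 0" using assms has_degree_pos by blast
  obtain S R where SR: "smult (lead_coeff F ^ Suc (degree G)) G = S * F + R" "degree R < degree F"
    using pseudo_division_poly_length[of F G "Suc (degree G)"] n assms(3) by auto
  have "ipoly R x = 0"
    using arg_cong[OF SR(1), of "\<lambda>P. ipoly P x"] assms by simp
  hence "R = 0" using has_degreeD[OF assms(1), of R] SR(2) assms(3) by auto
  moreover have "F \<noteq> 0" using n assms(3) by auto
  ultimately show ?thesis using that[of "lead_coeff F ^ Suc (degree G)" S] SR(1) by simp
qed

text \<open>
  Division shows that a polynomial of least degree with root \<open>x\<close> divides a nonzero integer multiple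
  of every other polynomial with this root.  As an irreducible integer polynomial is a prime element
  and here not constant, that integer can be discarded.
\<close>

lemma irreducible_root_int:
  fixes M G :: "int poly"
  assumes "has_degree x n" "irreducible M" "ipoly M x = 0"
  shows "degree M = n" and "ipoly G x = 0 \<Longrightarrow> M dvd G"
proof -
  have n: "n > 0" using assms has_degree_pos by blast
  have prime: "prime_elem M" using assms(2) by (rule irreducible_imp_prime_poly)
  have M0: "M \<noteq> 0" using assms(2) by auto
  obtain F where F: "F \<noteq> 0" "degree F = n" "ipoly F x = 0"
    using assms(1) unfolding has_degree_def by auto
  obtain l S where lS: "l \<noteq> 0" "smult l M = S * F"
    using has_degree_rem_eq_0 assms F by metis
  have "M dvd S * F" using lS(2) by (metis dvd_smult dvd_refl)
  hence "M dvd F"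
  proof (rule prime_elem_dvd_multD[OF prime, THEN disjE])
    assume "M dvd S"
    then obtain U where "S = M * U" by auto
    hence "M * [:l:] = M * (U * F)" using lS(2) by (simp add: mult_ac)
    hence "[:l:] = U * F" using M0 by (simp only: mult_cancel_left) auto
    moreover from this have "U \<noteq> 0" using lS(1) by auto
    ultimately have "degree [:l:] = degree U + degree F" using F(1) degree_mult_eq by metis
    thus ?thesis using n F by simp
  qed
  hence "degree M \<le> n" using dvd_imp_degree_le F by blast
  moreover have "n \<le> degree M" using has_degreeD[OF assms(1) M0 assms(3)] .
  ultimately show deg: "degree M = n" by simp
  assume G: "ipoly G x = 0"
  obtain l S where lS: "l \<noteq> 0" "smult l G = S * M"
    using has_degree_rem_eq_0 assms deg G by metis
  have "M dvd [:l:] * G" using lS(2) by simp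
  moreover have "\<not>M dvd [:l:]"
  proof
    assume "M dvd [:l:]"
    hence "degree M \<le> degree [:l:]" using lS(1) by (intro dvd_imp_degree_le) auto
    thus False using deg n by simp
  qed
  ultimately show "M dvd G" using prime_elem_dvd_multD[OF prime] by blast
qed

lemma exists_irreducible_root:
  fixes P :: "int poly"
  assumes "P \<noteq> 0" "ipoly P x = 0"
  shows "\<exists>M. irreducible M \<and> ipoly M x = 0"
  using assms
proof (induction P rule: prime_divisors_induct)
  case (unit P)
  then obtain c where "P = [:c:]" by (auto simp: is_unit_poly_iff)
  thus ?case using unit by simp
next
  case (factor p P)
  show ?case
  proof (cases "ipoly p x = 0")
    case True
    thus ?thesis using factor by (auto intro: prime_elem_imp_irreducible)
  next
    case False
    thus ?thesis using factor by auto
  qed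
qed simp_all

lemma int_min_poly:
  assumes "algebraic x"
  shows "irreducible (int_min_poly x)" "ipoly (int_min_poly x) x = 0"
proof -
  from assms obtain P where "ipoly P x = 0" "P \<noteq> 0" by (auto elim: algebraicE')
  hence "\<exists>M. irreducible M \<and> ipoly M x = 0" using exists_irreducible_root by blast
  from someI_ex[OF this] show "irreducible (int_min_poly x)" "ipoly (int_min_poly x) x = 0"
    unfolding int_min_poly_def by auto
qed

lemma alg_degree_eq:
  assumes "has_degree x n"
  shows "alg_degree x = n"
proof -
  have n: "n > 0" using assms has_degree_pos by blast
  obtain F where F: "F \<noteq> 0" "degree F = n" "ipoly F x = 0"
    using assms unfolding has_degree_def by auto
  define F' :: "rat poly" where "F' = map_poly of_int F"
  have F': "F' \<noteq> 0" "degree F' = n" "rpoly F' x = 0"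
    using F by (auto simp: F'_def degree_map_poly map_poly_eq_0_iff map_poly_map_poly o_def)
  define P where "P = smult (inverse (lead_coeff F')) F'"
  have P: "lead_coeff P = 1" "degree P = n" "rpoly P x = 0"
    using F' leading_coeff_0_iff[of F'] by (auto simp: P_def)
  have P0: "P \<noteq> 0" using P by auto
  have irred: "irreducible P"
  proof (rule irreducibleI)
    show "P \<noteq> 0" by fact
    show "\<not>P dvd 1" using P n by (auto simp: is_unit_poly_iff)
    fix A B assume AB: "P = A * B"
    hence nz: "A \<noteq> 0" "B \<noteq> 0" using P0 by auto
    hence deg: "degree A + degree B = n" using P AB degree_mult_eq by metis
    have "rpoly A x = 0 \<or> rpoly B x = 0" using P(3) AB by simp
    hence "n \<le> degree A \<or> n \<le> degree B" using has_degreeD_rat[OF assms] nz by blast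
    hence "degree A = 0 \<or> degree B = 0" using deg by auto
    thus "A dvd 1 \<or> B dvd 1" using nz by (auto simp: is_unit_iff_degree)
  qed
  have "rat_min_poly x = P"
    unfolding rat_min_poly_def
  proof (rule the_equality)
    show "lead_coeff P = 1 \<and> irreducible P \<and> rpoly P x = 0" using P irred by auto
    fix Q assume Q: "lead_coeff Q = 1 \<and> irreducible Q \<and> rpoly Q x = 0"
    have "rpoly (Q mod P) x = 0"
    proof -
      have "rpoly (P * (Q div P) + Q mod P) x = rpoly Q x" by simp
      thus ?thesis using Q P(3) by (simp only: rpoly_add rpoly_mult) simp
    qed
    hence "Q mod P = 0"
      using has_degreeD_rat[OF assms, of "Q mod P"] degree_mod_less[OF P0, of Q] P(2)
      by (metis not_le)
    then obtain U where U: "Q = P * U" by (metis dvd_eq_mod_eq_0 dvdE)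
    have "\<not>P dvd 1" using P n by (auto simp: is_unit_poly_iff)
    hence "U dvd 1" using Q U irreducibleD by blast
    then obtain u where "U = [:u:]" by (auto simp: is_unit_poly_iff)
    moreover have "lead_coeff U = 1" using Q U P(1) by (simp add: lead_coeff_mult)
    ultimately show "Q = P" using U by simp
  qed
  thus ?thesis using P by (simp add: alg_degree_def)
qed

lemma algebraic_has_degree: "algebraic x \<Longrightarrow> has_degree x (alg_degree x)"
  by (metis alg_degree_eq algebraic_imp_has_degree)

lemma degree_int_min_poly: "algebraic x \<Longrightarrow> degree (int_min_poly x) = alg_degree x"
  using irreducible_root_int(1) algebraic_has_degree int_min_poly by blast

lemma abs_coeff_le_height: "\<bar>coeff P i\<bar> \<le> poly_height P"
proof (cases "i \<le> degree P")
  case True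
  thus ?thesis unfolding poly_height_def by (intro Max_ge) auto
next
  case False
  have "0 \<le> \<bar>coeff P 0\<bar>" by simp
  also have "\<dots> \<le> poly_height P" unfolding poly_height_def by (intro Max_ge) auto
  finally show ?thesis using False by (simp add: coeff_eq_0)
qed

lemma height_ge_1: "P \<noteq> 0 \<Longrightarrow> poly_height P \<ge> 1"
  using abs_coeff_le_height[of P "degree P"] leading_coeff_0_iff[of P] by linarith

lemma poly_length_le_height: "poly_length P \<le> int (Suc (degree P)) * poly_height P"
  using sum_bounded_above[of "{..degree P}" "\<lambda>i. \<bar>coeff P i\<bar>" "poly_height P"] abs_coeff_le_height
  by (simp add: poly_length_def)

text \<open>
  An annihilating polynomial of least degree is a nonzero integer multiple of the minimal polynomial.
\<close>

lemma height_int_min_poly_le: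
  assumes "has_degree x n" "G \<noteq> 0" "ipoly G x = 0" "degree G \<le> n"
  shows "poly_height (int_min_poly x) \<le> poly_length G"
proof -
  define M where "M = int_min_poly x"
  have alg: "algebraic x" using assms(1) by (rule has_degree_imp_algebraic)
  have M: "irreducible M" "ipoly M x = 0" unfolding M_def using int_min_poly[OF alg] by auto
  have deg: "degree M = n" and "M dvd G"
    using irreducible_root_int[OF assms(1) M] assms(3) by auto
  then obtain U where U: "G = M * U" by auto
  have nz: "M \<noteq> 0" "U \<noteq> 0" using U assms(2) by auto
  have "degree U = 0" using assms(4) deg U degree_mult_eq[OF nz] by simp
  then obtain u where u: "U = [:u:]" by (auto elim: degree_eq_zeroE)
  have "u \<noteq> 0" using nz u by auto
  hence u1: "\<bar>u\<bar> \<ge> 1" by linarith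
  have "\<bar>coeff M i\<bar> \<le> poly_length G" for i
  proof -
    have "\<bar>coeff M i\<bar> \<le> \<bar>u\<bar> * \<bar>coeff M i\<bar>" using u1 mult_right_mono[of 1 "\<bar>u\<bar>" "\<bar>coeff M i\<bar>"] by simp
    also have "\<dots> = \<bar>coeff G i\<bar>" by (simp add: U u abs_mult)
    also have "\<dots> \<le> poly_length G" by (rule abs_coeff_le_poly_length)
    finally show ?thesis .
  qed
  thus ?thesis unfolding M_def poly_height_def by (subst Max_le_iff) auto
qed

text \<open>
  Northcott's theorem: there are only finitely many integer polynomials of bounded degree and
  height.
\<close>

lemma finite_bounded_height:
  "finite {x. algebraic x \<and> alg_degree x = k \<and> real_of_int (poly_height (int_min_poly x)) \<le> B}"
    (is "finite ?A")
proof -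
  define N where "N = \<lfloor>B\<rfloor>"
  define Ps :: "int poly set" where "Ps = {P. P \<noteq> 0 \<and> degree P \<le> k \<and> (\<forall>i. \<bar>coeff P i\<bar> \<le> N)}"
  have "Ps \<subseteq> Poly ` {xs. set xs \<subseteq> {-N..N} \<and> length xs \<le> Suc k}"
  proof
    fix P assume P: "P \<in> Ps"
    have "set (coeffs P) \<subseteq> {-N..N}"
      using P by (force simp: Ps_def coeffs_def abs_le_iff minus_le_iff)
    moreover have "length (coeffs P) \<le> Suc k" using P by (simp add: Ps_def length_coeffs_degree)
    ultimately show "P \<in> Poly ` {xs. set xs \<subseteq> {-N..N} \<and> length xs \<le> Suc k}"
      by (intro image_eqI[of _ _ "coeffs P"]) auto
  qed
  hence "finite Ps"
    by (rule finite_subset) (intro finite_imageI finite_lists_length_le, simp)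
  moreover have "finite {x. ipoly P x = 0}" if "P \<in> Ps" for P
    using that by (intro poly_roots_finite) (auto simp: Ps_def map_poly_eq_0_iff)
  ultimately have "finite (\<Union>P\<in>Ps. {x. ipoly P x = 0})" by blast
  moreover have "?A \<subseteq> (\<Union>P\<in>Ps. {x. ipoly P x = 0})"
  proof
    fix x assume x: "x \<in> ?A"
    define M where "M = int_min_poly x"
    have M: "irreducible M" "ipoly M x = 0" "degree M = k"
      using x int_min_poly[of x] degree_int_min_poly[of x] by (auto simp: M_def)
    have "poly_height M \<le> N" using x unfolding N_def M_def by (simp add: le_floor_iff)
    hence "\<bar>coeff M i\<bar> \<le> N" for i using abs_coeff_le_height[of M i] by linarith
    moreover have "M \<noteq> 0" using M(1) by auto
    ultimately have "M \<in> Ps" using M by (auto simp: Ps_def)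
    thus "x \<in> (\<Union>P\<in>Ps. {x. ipoly P x = 0})" using M by blast
  qed
  ultimately show ?thesis using finite_subset by blast
qed

lemma ipoly_nonzero_point:
  assumes "P \<noteq> 0"
  obtains x where "ipoly P x \<noteq> 0"
proof -
  have "finite {x. ipoly P x = 0}"
    using assms by (intro poly_roots_finite) (auto simp: map_poly_eq_0_iff)
  hence "{x. ipoly P x = 0} \<noteq> UNIV" using infinite_UNIV_char_0[where ?'a = complex] by auto
  thus ?thesis using that by blast
qed

lemma ipoly_shift_nonzero:
  fixes P :: "int poly" and s u :: int
  assumes "degree P \<le> d" "s > 0" "P \<noteq> 0"
  obtains Q where "Q \<noteq> 0" "degree Q \<le> d" "poly_length Q \<le> poly_length P * (s + \<bar>u\<bar>) ^ d"
    "\<And>x. ipoly Q x = of_int s ^ d * ipoly P (x + of_int u / of_int s)"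
proof -
  obtain Q where Q: "degree Q \<le> d" "poly_length Q \<le> poly_length P * (s + \<bar>u\<bar>) ^ d"
    "\<And>x. ipoly Q x = of_int s ^ d * ipoly P (x + of_int u / of_int s)"
    using ipoly_shift[OF assms(1,2)] by blast
  obtain x where "ipoly P x \<noteq> 0" using ipoly_nonzero_point assms(3) by blast
  hence "ipoly Q (x - of_int u / of_int s) \<noteq> 0" using Q(3) assms(2) by simp
  hence "Q \<noteq> 0" by auto
  thus ?thesis using that Q by blast
qed

text \<open>
  Translating by \<open>u / s\<close> and by its negative carries annihilating polynomials of the two numbers to
  each other without increasing degrees.
\<close>

lemma has_degree_shift:
  assumes "has_degree \<theta> m" "s > 0"
  shows "has_degree (\<theta> + of_int u / of_int s) m"
proof -
  define y where "y = \<theta> + of_int u / of_int s"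
  obtain F where F: "F \<noteq> 0" "degree F = m" "ipoly F \<theta> = 0"
    using assms(1) unfolding has_degree_def by auto
  obtain Q where Q: "Q \<noteq> 0" "degree Q \<le> m"
    "\<And>x. ipoly Q x = of_int s ^ m * ipoly F (x + of_int (-u) / of_int s)"
    using ipoly_shift_nonzero[of F m s "-u"] F(1,2) assms(2) by (metis order_refl)
  have lower: "m \<le> degree P" if P: "P \<noteq> 0" "ipoly P y = 0" for P
  proof -
    obtain R where R: "R \<noteq> 0" "degree R \<le> degree P"
      "\<And>x. ipoly R x = of_int s ^ degree P * ipoly P (x + of_int u / of_int s)"
      using ipoly_shift_nonzero[of P "degree P" s u] P(1) assms(2) by (metis order_refl)
    have "ipoly R \<theta> = 0" using R(3) P(2) by (simp add: y_def)
    thus ?thesis using has_degreeD[OF assms(1) R(1)] R(2) by linarith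
  qed
  have "ipoly Q y = 0" using Q(3)[of y] F(3) by (simp add: y_def)
  hence "degree Q = m" using lower[of Q] Q(1,2) by simp
  hence "has_degree y m"
    unfolding has_degree_def using \<open>ipoly Q y = 0\<close> Q(1) lower not_le by blast
  thus ?thesis by (simp add: y_def)
qed

section \<open>Radicals and polynomial expressions in them\<close>

lemma of_real_of_rat: "complex_of_real (of_rat q) = of_rat q"
  by (cases q) (simp add: of_rat_rat)

lemma norm_of_rat: "norm (of_rat q :: complex) = of_rat \<bar>q\<bar>"
proof -
  have "norm (of_rat q :: complex) = \<bar>of_rat q :: real\<bar>"
    by (simp flip: of_real_of_rat)
  thus ?thesis by (simp add: abs_if of_rat_minus)
qed

lemma rpoly_eq_sum:
  assumes "degree P < n"
  shows "rpoly P x = (\<Sum>i<n. of_rat (coeff P i) * x ^ i)"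
proof -
  have "rpoly P x = (\<Sum>i\<le>degree P. of_rat (coeff P i) * x ^ i)"
    by (simp add: poly_altdef degree_map_poly coeff_map_poly)
  also have "\<dots> = (\<Sum>i<n. of_rat (coeff P i) * x ^ i)"
    using assms by (intro sum.mono_neutral_left) (auto simp: coeff_eq_0)
  finally show ?thesis .
qed

text \<open>
  Dimension count: \<open>n > d\<close> rational combinations of \<open>1, y, \<dots>, y ^ (d - 1)\<close> are linearly dependent
  over the rationals.  The coefficients of the dependency are those of a polynomial \<open>C\<close>, ready
  to be evaluated.
\<close>

lemma rational_dependence:
  fixes v :: "nat \<Rightarrow> complex" and B :: "nat \<Rightarrow> rat poly"
  assumes v: "\<And>i. i < n \<Longrightarrow> v i = rpoly (B i) y" and B: "\<And>i. i < n \<Longrightarrow> degree (B i) < d"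
    and "d < n"
  obtains C where "C \<noteq> 0" "degree C < n" "(\<Sum>i<n. of_rat (coeff C i) * v i) = 0"
proof -
  interpret Q: vector_space "\<lambda>(q::rat) (x::complex). of_rat q * x"
    by unfold_locales (simp_all add: of_rat_add of_rat_mult algebra_simps)
  have span: "v i \<in> Q.span ((\<lambda>s. y ^ s) ` {..<d})" if "i < n" for i
  proof -
    have "v i = (\<Sum>s<d. of_rat (coeff (B i) s) * y ^ s)"
      using v[OF that] rpoly_eq_sum[OF B[OF that]] by simp
    also have "\<dots> \<in> Q.span ((\<lambda>s. y ^ s) ` {..<d})"
      by (intro Q.span_sum Q.span_scale Q.span_base) auto
    finally show ?thesis .
  qed
  have "\<exists>c. (\<exists>i<n. c i \<noteq> 0) \<and> (\<Sum>i<n. of_rat (c i) * v i) = 0"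
  \<comment> \<open>A repetition in the family is itself a dependency, but is invisible in the set of its members.\<close>
  proof (cases "inj_on v {..<n}")
    case True
    have "Q.dependent (v ` {..<n})"
    proof (rule ccontr)
      assume "Q.independent (v ` {..<n})"
      hence "card (v ` {..<n}) \<le> card ((\<lambda>s. y ^ s) ` {..<d})"
        using Q.independent_span_bound[of "(\<lambda>s. y ^ s) ` {..<d}" "v ` {..<n}"] span by blast
      also have "\<dots> \<le> d" using card_image_le[of "{..<d}" "\<lambda>s. y ^ s"] by simp
      finally show False using \<open>d < n\<close> True by (simp add: card_image)
    qed
    then obtain u where u: "\<exists>x\<in>v ` {..<n}. u x \<noteq> 0" "(\<Sum>x\<in>v ` {..<n}. of_rat (u x) * x) = 0"
      using Q.dependent_finite[of "v ` {..<n}"] by auto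
    thus ?thesis
      by (intro exI[of _ "\<lambda>i. u (v i)"]) (auto simp: sum.reindex[OF True])
  next
    case False
    then obtain i j where ij: "i < n" "j < n" "i \<noteq> j" "v i = v j"
      by (auto simp: inj_on_def)
    define c :: "nat \<Rightarrow> rat" where "c = (\<lambda>k. if k = i then 1 else if k = j then -1 else 0)"
    have "(\<Sum>k<n. of_rat (c k) * v k) = (\<Sum>k\<in>{i, j}. of_rat (c k) * v k)"
      using ij by (intro sum.mono_neutral_right) (auto simp: c_def)
    also have "\<dots> = 0" using ij by (simp add: c_def)
    finally show ?thesis using ij(1) by (intro exI[of _ c]) (auto simp: c_def)
  qed
  then obtain c k where c: "k < n" "c k \<noteq> 0" "(\<Sum>i<n. of_rat (c i) * v i) = 0" by blast
  define C where "C = (\<Sum>i<n. monom (c i) i)"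
  have C: "coeff C i = (if i < n then c i else 0)" for i
    by (simp add: C_def coeff_sum)
  show ?thesis
  proof (rule that)
    show "C \<noteq> 0" using C[of k] c by auto
    have "degree C \<le> n - 1" by (intro degree_le) (auto simp: C)
    thus "degree C < n" using c(1) by linarith
    show "(\<Sum>i<n. of_rat (coeff C i) * v i) = 0" using c(3) by (simp add: C)
  qed
qed

text \<open>
  After cancelling the common factor of \<open>m\<close> and \<open>d\<close>, Bezout's identity writes \<open>\<alpha>\<close> as an
  \<open>m'\<close>-th power, where \<open>m' = m / gcd d m > 1\<close>.
\<close>

lemma rat_power_of_power_eq:
  fixes r \<alpha> :: rat
  assumes "r > 0" "\<alpha> > 0" "r ^ m = \<alpha> ^ d" "0 < d" "d < m"
  shows "\<exists>p q. prime p \<and> p dvd m \<and> \<alpha> = q ^ p"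
proof -
  define e where "e = gcd d m"
  obtain d' m' where dm: "d = e * d'" "m = e * m'" unfolding e_def by (meson dvdE gcd_dvd1 gcd_dvd2)
  have e: "e > 0" using assms by (simp add: e_def)
  have "e * gcd d' m' = e" using dm e_def by (metis gcd_mult_distrib_nat)
  hence cop: "gcd d' m' = 1" using e by simp
  have "(r ^ m') ^ e = (\<alpha> ^ d') ^ e" using assms(3) dm by (simp add: mult.commute flip: power_mult)
  hence eq: "r ^ m' = \<alpha> ^ d'"
    using assms e by (metis power_eq_iff_eq_base zero_le_power less_imp_le)
  have "d' \<noteq> 0" using dm assms by auto
  then obtain x y where xy: "d' * x = m' * y + 1"
    using bezout_nat[of d' m'] cop by auto
  define q where "q = r ^ x / \<alpha> ^ y"
  have "\<alpha> * \<alpha> ^ (m' * y) = \<alpha> ^ (d' * x)" by (simp add: xy)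
  also have "\<dots> = (r ^ m') ^ x" by (simp only: power_mult eq)
  also have "\<dots> = (r ^ x) ^ m'" by (simp add: mult.commute flip: power_mult)
  finally have "\<alpha> = q ^ m'"
    using assms by (simp add: q_def field_simps power_divide flip: power_mult)
  have "m' \<noteq> 1" using dm assms(4,5) \<open>d' \<noteq> 0\<close> e by auto
  then obtain p where p: "prime p" "p dvd m'" using prime_factor_nat by blast
  then obtain t where t: "m' = p * t" by auto
  have "\<alpha> = (q ^ t) ^ p" using \<open>\<alpha> = q ^ m'\<close> t by (simp add: mult.commute flip: power_mult)
  moreover have "p dvd m" using p dm by auto
  ultimately show ?thesis using p by blast
qed

locale radical =
  fixes m :: nat and \<alpha> :: rat
  assumes m_pos: "m > 0" and \<alpha>_pos: "\<alpha> > 0"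
    and not_power: "\<And>p q. prime p \<Longrightarrow> p dvd m \<Longrightarrow> \<alpha> \<noteq> q ^ p"
begin

definition radical_poly :: "rat poly" where "radical_poly = monom 1 m - [:\<alpha>:]"

lemma rpoly_radical_poly: "rpoly radical_poly x = x ^ m - of_rat \<alpha>"
  by (simp add: radical_poly_def)

lemma degree_radical_poly [simp]: "degree radical_poly = m"
proof -
  have "radical_poly = monom 1 m + [:-\<alpha>:]" by (simp add: radical_poly_def)
  thus ?thesis using m_pos by (simp add: degree_add_eq_left degree_monom_eq)
qed

lemma radical_poly_nz [simp]: "radical_poly \<noteq> 0"
  using degree_radical_poly m_pos by (metis degree_0 less_irrefl)

text \<open>
  Irreducibility of \<open>X ^ m - \<alpha>\<close>.  All its roots have the same modulus, so the constant coefficient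
  of a monic factor of degree \<open>d\<close> has a rational absolute value whose \<open>m\<close>-th power is \<open>\<alpha> ^ d\<close>.
  Positivity of \<open>\<alpha>\<close> excludes the exceptional factorisation of \<open>X ^ 4 + 4 q ^ 4\<close>.
\<close>

lemma degree_root_ge:
  assumes a: "a ^ m = of_rat \<alpha>" and P: "P \<noteq> 0" "rpoly P a = 0"
  shows "m \<le> degree P"
proof -
  define A where "A = (\<lambda>n. \<exists>P. P \<noteq> 0 \<and> degree P = n \<and> rpoly P a = 0)"
  define d where "d = (LEAST n. A n)"
  have "A (degree P)" using P by (auto simp: A_def)
  hence "A d" "d \<le> degree P" unfolding d_def by (auto intro: LeastI Least_le)
  then obtain M where M: "M \<noteq> 0" "degree M = d" "rpoly M a = 0" by (auto simp: A_def)
  have min: "d \<le> degree Q" if "Q \<noteq> 0" "rpoly Q a = 0" for Q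
    unfolding d_def using that by (intro Least_le) (auto simp: A_def)
  have "d > 0" using M by (intro Nat.gr0I) (auto elim!: degree_eq_zeroE)
  have "m \<le> d"
  proof (rule ccontr)
    assume "\<not>m \<le> d"
    have "rpoly (M * (radical_poly div M) + radical_poly mod M) a = rpoly radical_poly a" by simp
    hence "rpoly (radical_poly mod M) a = 0"
      using M(3) by (simp only: rpoly_add rpoly_mult) (simp add: rpoly_radical_poly a)
    hence "radical_poly mod M = 0" using min[of "radical_poly mod M"] degree_mod_less[OF M(1), of radical_poly] M(2)
      by (metis not_le)
    then obtain U where U: "radical_poly = M * U" by (metis dvd_eq_mod_eq_0 dvdE)
    define l where "l = lead_coeff M"
    have l: "l \<noteq> 0" using M by (metis l_def leading_coeff_0_iff)
    have "map_poly of_rat M \<noteq> (0 :: complex poly)" using M by (simp add: map_poly_eq_0_iff)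
    then obtain X :: "complex multiset" where X: "size X = degree (map_poly of_rat M :: complex poly)"
      "map_poly of_rat M = smult (lead_coeff (map_poly of_rat M :: complex poly)) (\<Prod>x\<in>#X. [:-x, 1:])"
      using alg_closed_imp_factorization[of "map_poly of_rat M"] by blast
    have sX: "size X = d" using X(1) M by (simp add: degree_map_poly)
    have "lead_coeff (map_poly of_rat M) = (of_rat l :: complex)"
      by (simp add: l_def degree_map_poly coeff_map_poly)
    hence eq: "rpoly M z = of_rat l * (\<Prod>x\<in>#X. z - x)" for z
      by (subst X(2)) (simp add: poly_prod_mset image_mset.compositionality o_def)
    have root: "norm x ^ m = of_rat \<alpha>" if "x \<in># X" for x
    proof -
      have "(\<Prod>z\<in>#X. x - z) = 0" using that by (auto simp: prod_mset_zero_iff)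
      hence "rpoly radical_poly x = 0" using U eq[of x] by simp
      hence "x ^ m = of_rat \<alpha>" by (simp add: rpoly_radical_poly)
      hence "norm (x ^ m) = norm (of_rat \<alpha> :: complex)" by simp
      thus ?thesis using \<alpha>_pos by (simp add: norm_power norm_of_rat)
    qed
    have prodn: "norm (\<Prod>x\<in>#X. 0 - x) ^ m = of_rat \<alpha> ^ size X"
      using root by (induction X) (auto simp: norm_mult power_mult_distrib)
    define r where "r = \<bar>poly M 0 / l\<bar>"
    have "rpoly M 0 = of_rat (poly M 0)" by (simp add: poly_0_coeff_0 coeff_map_poly)
    hence "of_rat (poly M 0 / l) = (\<Prod>x\<in>#X. 0 - x)" using eq[of 0] l by (simp add: of_rat_divide nonzero_divide_eq_eq mult.commute)
    hence "norm (of_rat (poly M 0 / l) :: complex) ^ m = of_rat \<alpha> ^ d" using prodn sX by simp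
    moreover have "norm (of_rat (poly M 0 / l) :: complex) = of_rat r"
      by (simp add: r_def norm_of_rat)
    ultimately have "of_rat (r ^ m) = (of_rat (\<alpha> ^ d) :: real)" by (simp add: of_rat_power)
    hence rm: "r ^ m = \<alpha> ^ d" by (simp only: of_rat_eq_iff)
    hence "r \<noteq> 0" using \<alpha>_pos m_pos by (metis less_irrefl power_0_left zero_less_power)
    hence "r > 0" by (simp add: r_def)
    then obtain p q where "prime p" "p dvd m" "\<alpha> = q ^ p"
      using rat_power_of_power_eq[OF _ \<alpha>_pos rm \<open>d > 0\<close>] \<open>\<not>m \<le> d\<close> not_le by blast
    thus False using not_power by blast
  qed
  thus ?thesis using \<open>d \<le> degree P\<close> by linarith
qed

lemma conjugate_root:
  assumes "a ^ m = of_rat \<alpha>" "rpoly P a = 0" "b ^ m = of_rat \<alpha>"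
  shows "rpoly P b = 0"
proof -
  have "rpoly (radical_poly * (P div radical_poly) + P mod radical_poly) a = rpoly P a" by simp
  hence "rpoly (P mod radical_poly) a = 0"
    using assms by (simp only: rpoly_add rpoly_mult) (simp add: rpoly_radical_poly)
  hence "P mod radical_poly = 0"
    using degree_root_ge[OF assms(1), of "P mod radical_poly"] degree_mod_less[OF radical_poly_nz, of P]
    by (metis degree_radical_poly not_le)
  then obtain U where "P = radical_poly * U" by (metis dvd_eq_mod_eq_0 dvdE)
  thus ?thesis using assms(3) by (simp add: rpoly_radical_poly)
qed

definition roots :: "complex set" where "roots = {x. x ^ m = of_rat \<alpha>}"

lemma finite_roots [simp]: "finite roots"
  unfolding roots_def using m_pos by (intro finite_nth_roots)

text \<open>
  Multiplication by a primitive \<open>m\<close>-th root of unity permutes the roots, so the power sum vanishes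
  unless \<open>m\<close> divides \<open>k\<close>.
\<close>

lemma power_sum_rat: "(\<Sum>x\<in>roots. x ^ k) \<in> \<rat>"
proof (cases "m dvd k")
  case True
  then obtain t where t: "k = m * t" by auto
  have "(\<Sum>x\<in>roots. x ^ k) = (\<Sum>x\<in>roots. of_rat \<alpha> ^ t)"
    by (intro sum.cong) (auto simp: roots_def t power_mult)
  thus ?thesis by auto
next
  case False
  define \<omega> where "\<omega> = cis (2 * pi * 1 / m)"
  have pow: "\<omega> ^ i = cis (2 * pi * real i / m)" for i
    unfolding \<omega>_def Complex.DeMoivre by (simp add: mult_ac)
  have \<omega>m: "\<omega> ^ m = 1" using m_pos by (simp add: pow)
  have \<omega>0: "\<omega> \<noteq> 0" by (simp add: \<omega>_def)
  have "\<omega> ^ k = \<omega> ^ (m * (k div m) + k mod m)" by simp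
  also have "\<dots> = \<omega> ^ (k mod m)" by (simp only: power_add power_mult \<omega>m) simp
  also have "\<dots> \<noteq> 1"
  proof
    assume "\<omega> ^ (k mod m) = 1"
    hence "cis (2 * pi * real (k mod m) / m) = cis (2 * pi * real 0 / m)" by (simp add: pow)
    moreover have "inj_on (\<lambda>k. cis (2 * pi * real k / real m)) {..<m}"
      using Complex.bij_betw_roots_unity[OF m_pos] by (simp add: bij_betw_def)
    ultimately have "k mod m = 0" using m_pos
      inj_onD[of "\<lambda>k. cis (2 * pi * real k / real m)" "{..<m}" "k mod m" 0] by simp
    thus False using False by auto
  qed
  finally have "\<omega> ^ k \<noteq> 1" .
  have "bij_betw (\<lambda>x. \<omega> * x) roots roots"
    by (intro bij_betwI[of _ _ _ "\<lambda>x. x / \<omega>"])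
       (auto simp: roots_def power_mult_distrib power_divide \<omega>m \<omega>0)
  hence "(\<Sum>x\<in>roots. (\<omega> * x) ^ k) = (\<Sum>x\<in>roots. x ^ k)"
    by (rule sum.reindex_bij_betw)
  hence "\<omega> ^ k * (\<Sum>x\<in>roots. x ^ k) = (\<Sum>x\<in>roots. x ^ k)"
    by (simp add: power_mult_distrib sum_distrib_left)
  hence "(\<Sum>x\<in>roots. x ^ k) = 0" using \<open>\<omega> ^ k \<noteq> 1\<close> by simp
  thus ?thesis by simp
qed

lemma trace_rat: "(\<Sum>x\<in>roots. rpoly Q x) \<in> \<rat>"
proof -
  have "(\<Sum>x\<in>roots. rpoly Q x) = (\<Sum>x\<in>roots. \<Sum>k\<le>degree Q. of_rat (coeff Q k) * x ^ k)"
    by (simp add: poly_altdef degree_map_poly coeff_map_poly)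
  also have "\<dots> = (\<Sum>k\<le>degree Q. of_rat (coeff Q k) * (\<Sum>x\<in>roots. x ^ k))"
    by (subst sum.swap) (simp add: sum_distrib_left)
  also have "\<dots> \<in> \<rat>" by (intro Rats_sum Rats_mult power_sum_rat) auto
  finally show ?thesis .
qed

text \<open>
  Let \<open>M\<close> be the minimal polynomial of \<open>\<theta> = g(b)\<close>, of degree \<open>d\<close>, and let \<open>D(x)\<close> be the difference
  quotient \<open>(M(x) - M(\<theta>)) / (x - \<theta>)\<close>.  It vanishes at the values \<open>g(x)\<close> for the other roots \<open>x\<close>
  of \<open>X ^ m - \<alpha>\<close>, since these are roots of \<open>M\<close> distinct from \<open>\<theta>\<close>.  Hence the sum of
  \<open>x ^ j * D(g(x))\<close> over all roots reduces to \<open>b ^ j * D(\<theta>)\<close>.  On the other hand the sum is a combination of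
  \<open>1, \<theta>, \<dots>, \<theta> ^ (d - 1)\<close> whose coefficients are rational by \<open>trace_rat\<close>.  As \<open>D(\<theta>) = M'(\<theta>) \<noteq> 0\<close> and
  the \<open>m\<close> numbers \<open>b ^ j\<close> are linearly independent, \<open>m \<le> d\<close>.
\<close>

lemma degree_ge_of_simple_value:
  fixes g P :: "rat poly"
  assumes b: "b \<in> roots" and simple: "\<And>x. x \<in> roots \<Longrightarrow> x \<noteq> b \<Longrightarrow> rpoly g x \<noteq> rpoly g b"
    and P: "P \<noteq> 0" "rpoly P (rpoly g b) = 0"
  shows "m \<le> degree P"
proof -
  define \<theta> where "\<theta> = rpoly g b"
  define A where "A = (\<lambda>n. \<exists>P. P \<noteq> 0 \<and> degree P = n \<and> rpoly P \<theta> = 0)"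
  define d where "d = (LEAST n. A n)"
  have "A (degree P)" using P by (auto simp: A_def \<theta>_def)
  hence "A d" "d \<le> degree P" unfolding d_def by (auto intro: LeastI Least_le)
  then obtain M where M: "M \<noteq> 0" "degree M = d" "rpoly M \<theta> = 0" by (auto simp: A_def)
  have min: "d \<le> degree Q" if "Q \<noteq> 0" "rpoly Q \<theta> = 0" for Q
    unfolding d_def using that by (intro Least_le) (auto simp: A_def)
  have d0: "d > 0" using M by (intro Nat.gr0I) (auto elim!: degree_eq_zeroE)
  define D where "D = (\<lambda>x. \<Sum>l\<le>d. of_rat (coeff M l) * (\<Sum>i<l. \<theta> ^ (l - Suc i) * x ^ i))"
  have rM: "rpoly M x = (\<Sum>l\<le>d. of_rat (coeff M l) * x ^ l)" for x
    by (simp add: poly_altdef degree_map_poly coeff_map_poly M)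
  have D: "rpoly M x - rpoly M \<theta> = (x - \<theta>) * D x" for x
  proof -
    have "rpoly M x - rpoly M \<theta> = (\<Sum>l\<le>d. of_rat (coeff M l) * (x ^ l - \<theta> ^ l))"
      by (simp add: rM sum_subtractf algebra_simps)
    also have "\<dots> = (x - \<theta>) * D x"
      by (simp add: D_def power_diff_sumr2 sum_distrib_left mult_ac)
    finally show ?thesis .
  qed
  have "D \<theta> \<noteq> 0"
  proof
    assume *: "D \<theta> = 0"
    have "D \<theta> = (\<Sum>l\<le>d. of_rat (coeff M l) * (of_nat l * \<theta> ^ (l - 1)))"
      unfolding D_def by (intro sum.cong refl arg_cong2[where f = "(*)"])
         (simp flip: power_add)
    also have "\<dots> = (\<Sum>l\<le>Suc (d - 1). of_rat (coeff M l) * (of_nat l * \<theta> ^ (l - 1)))"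
      using d0 by simp
    also have "\<dots> = (\<Sum>l\<le>d - 1. of_rat (coeff (pderiv M) l) * \<theta> ^ l)"
      by (subst sum.atMost_Suc_shift) (simp add: coeff_pderiv of_rat_mult of_rat_add mult_ac)
    also have "\<dots> = rpoly (pderiv M) \<theta>"
      by (simp add: poly_altdef degree_map_poly coeff_map_poly M degree_pderiv)
    finally have "rpoly (pderiv M) \<theta> = 0" using * by simp
    moreover have "pderiv M \<noteq> 0" using d0 M(2) pderiv_eq_0_iff[of M] by auto
    ultimately show False using min[of "pderiv M"] d0 by (simp add: degree_pderiv M)
  qed
  have D0: "D (rpoly g x) = 0" if "x \<in> roots" "x \<noteq> b" for x
  proof -
    have "rpoly (pcompose M g) x = 0"
      using conjugate_root[of b "pcompose M g" x] b that M(3) by (simp add: roots_def \<theta>_def)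
    thus ?thesis using D[of "rpoly g x"] simple[OF that] M(3) by (simp add: \<theta>_def)
  qed
  have "\<exists>B. b ^ j * D \<theta> = rpoly B \<theta> \<and> degree B < d" for j
  proof -
    define t where "t = (\<lambda>i. SOME q. of_rat q = (\<Sum>x\<in>roots. rpoly (monom 1 j * g ^ i) x))"
    have t: "of_rat (t i) = (\<Sum>x\<in>roots. x ^ j * rpoly g x ^ i)" for i
    proof -
      have "\<exists>q. of_rat q = (\<Sum>x\<in>roots. rpoly (monom 1 j * g ^ i) x)"
        using trace_rat[of "monom 1 j * g ^ i"] by (metis Rats_cases)
      from someI_ex[OF this] show ?thesis unfolding t_def by simp
    qed
    define B where "B = (\<Sum>l\<le>d. \<Sum>i<l. monom (coeff M l * t i) (l - Suc i))"
    have "b ^ j * D \<theta> = (\<Sum>x\<in>{b}. x ^ j * D (rpoly g x))" by (simp add: \<theta>_def)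
    also have "\<dots> = (\<Sum>x\<in>roots. x ^ j * D (rpoly g x))"
      using b D0 by (intro sum.mono_neutral_left) auto
    also have "\<dots> = (\<Sum>x\<in>roots. \<Sum>l\<le>d. \<Sum>i<l. 
                       of_rat (coeff M l) * \<theta> ^ (l - Suc i) * (x ^ j * rpoly g x ^ i))"
      by (simp add: D_def sum_distrib_left mult_ac)
    also have "\<dots> = (\<Sum>l\<le>d. \<Sum>i<l. \<Sum>x\<in>roots.
                       of_rat (coeff M l) * \<theta> ^ (l - Suc i) * (x ^ j * rpoly g x ^ i))"
      by (subst sum.swap, rule sum.cong[OF refl], rule sum.swap)
    also have "\<dots> = rpoly B \<theta>"
      unfolding B_def rpoly_sum rpoly_monom of_rat_mult t
      by (intro sum.cong refl) (simp add: sum_distrib_left mult_ac)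
    finally have "b ^ j * D \<theta> = rpoly B \<theta>" .
    moreover have "degree B \<le> d - 1"
      unfolding B_def by (intro degree_sum_le) (auto intro!: order.trans[OF degree_monom_le])
    ultimately show ?thesis using d0 by (intro exI[of _ B]) auto
  qed
  then obtain B where B: "\<And>j. b ^ j * D \<theta> = rpoly (B j) \<theta>" "\<And>j. degree (B j) < d" by metis
  have "m \<le> d"
  proof (rule ccontr)
    assume "\<not>m \<le> d"
    hence "d < m" by simp
    obtain C where C: "C \<noteq> 0" "degree C < m" "(\<Sum>i<m. of_rat (coeff C i) * (b ^ i * D \<theta>)) = 0"
      using rational_dependence[of m "\<lambda>j. b ^ j * D \<theta>" B \<theta> d] B \<open>d < m\<close> by blast
    have "rpoly C b * D \<theta> = (\<Sum>i<m. of_rat (coeff C i) * (b ^ i * D \<theta>))"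
      by (simp add: rpoly_eq_sum[OF C(2)] sum_distrib_right mult.assoc)
    hence "rpoly C b * D \<theta> = 0" using C(3) by (simp only:)
    hence "rpoly C b = 0" using \<open>D \<theta> \<noteq> 0\<close> by simp
    thus False using degree_root_ge[of b C] b C by (simp add: roots_def)
  qed
  thus ?thesis using \<open>d \<le> degree P\<close> by linarith
qed

text \<open>
  The \<open>m + 1\<close> powers \<open>g(a) ^ i\<close> lie in the span of \<open>1, a, \<dots>, a ^ (m - 1)\<close>.
\<close>

lemma exists_annihilator:
  assumes "a \<in> roots"
  obtains C where "C \<noteq> 0" "degree C \<le> m" "rpoly C (rpoly g a) = 0"
proof -
  have "rpoly (g ^ i mod radical_poly) a = rpoly g a ^ i" for i
  proof -
    have "rpoly g a ^ i = rpoly (radical_poly * (g ^ i div radical_poly) + g ^ i mod radical_poly) a" by simp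
    also have "\<dots> = rpoly (g ^ i mod radical_poly) a"
      using assms by (simp only: rpoly_add rpoly_mult) (simp add: rpoly_radical_poly roots_def)
    finally show ?thesis ..
  qed
  moreover have "degree (g ^ i mod radical_poly) < m" for i
    using degree_mod_less[OF radical_poly_nz, of "g ^ i"] m_pos by auto
  ultimately obtain C where C: "C \<noteq> 0" "degree C < Suc m"
    "(\<Sum>i<Suc m. of_rat (coeff C i) * rpoly g a ^ i) = 0"
    using rational_dependence[of "Suc m" "\<lambda>i. rpoly g a ^ i" "\<lambda>i. g ^ i mod radical_poly" a m] by auto
  have "rpoly C (rpoly g a) = 0"
    unfolding rpoly_eq_sum[OF C(2)] by (rule C(3))
  thus ?thesis using that C by auto
qed

text \<open>
  At the positive root \<open>b\<close> all summands are positive, so their sum exceeds the real part of the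
  value at any other root, already because of the linear term.  The conclusion passes from \<open>b\<close> to
  every other root \<open>a\<close> by conjugacy.
\<close>

lemma has_degree_factorial_sum:
  assumes a: "a ^ m = of_rat \<alpha>"
  shows "has_degree (\<Sum>n<m. a ^ fact (Suc n)) m"
proof -
  define g :: "rat poly" where "g = (\<Sum>n<m. monom 1 (fact (Suc n)))"
  have g: "rpoly g x = (\<Sum>n<m. x ^ fact (Suc n))" for x by (simp add: g_def)
  define r where "r = root m (of_rat \<alpha>)"
  define b where "b = complex_of_real r"
  have r: "r > 0" "r ^ m = of_rat \<alpha>" using m_pos \<alpha>_pos by (auto simp: r_def)
  have b: "b ^ m = of_rat \<alpha>"
    by (simp add: b_def r of_real_of_rat flip: of_real_power)
  have simple: "rpoly g x \<noteq> rpoly g b" if x: "x \<in> roots" "x \<noteq> b" for x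
  proof -
    have "norm x ^ m = norm (of_rat \<alpha> :: complex)"
      using x by (simp add: roots_def flip: norm_power)
    hence "norm x ^ m = r ^ m" using r \<alpha>_pos by (simp add: norm_of_rat)
    hence nx: "norm x = r" using r m_pos by (metis norm_ge_zero less_imp_le power_eq_iff_eq_base)
    have "Re x \<noteq> r"
    proof
      assume "Re x = r"
      hence "Im x = 0" using nx cmod_power2[of x] by simp
      hence "x = b" using \<open>Re x = r\<close> by (simp add: b_def complex_eq_iff)
      thus False using x by simp
    qed
    moreover have "Re x \<le> r" using complex_Re_le_cmod[of x] nx by simp
    ultimately have "Re (x ^ fact (Suc 0)) < r ^ fact (Suc 0)" by simp
    moreover have "Re (x ^ n) \<le> r ^ n" for n
      using complex_Re_le_cmod[of "x ^ n"] nx by (simp add: norm_power)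
    ultimately have "(\<Sum>n<m. Re (x ^ fact (Suc n))) < (\<Sum>n<m. r ^ fact (Suc n))"
      using m_pos by (intro sum_strict_mono_ex1 bexI[of _ 0]) auto
    hence "Re (rpoly g x) < Re (rpoly g b)"
      by (simp add: g b_def flip: of_real_power)
    thus ?thesis by auto
  qed
  have lower: "m \<le> degree P" if "P \<noteq> 0" "rpoly P (rpoly g a) = 0" for P
  proof -
    have "rpoly (pcompose P g) b = 0"
      using conjugate_root[of a "pcompose P g" b] a b that by simp
    thus ?thesis
      using degree_ge_of_simple_value[of b g P] simple that b by (simp add: roots_def)
  qed
  obtain C where C: "C \<noteq> 0" "degree C \<le> m" "rpoly C (rpoly g a) = 0"
    using exists_annihilator[of a g] a by (auto simp: roots_def)
  hence "degree C = m" using lower by (simp add: order.antisym)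
  obtain c Q where cQ: "c \<noteq> 0" "degree Q = degree C" "\<And>x. ipoly Q x = of_int c * rpoly C x"
    using clear_denominators by blast
  have "Q \<noteq> 0 \<and> degree Q = m \<and> ipoly Q (rpoly g a) = 0"
    using cQ C \<open>degree C = m\<close> m_pos by auto
  moreover have "m \<le> degree P" if "P \<noteq> 0" "ipoly P (rpoly g a) = 0" for P
    using lower[of "map_poly of_int P"] that
    by (auto simp: degree_map_poly map_poly_eq_0_iff map_poly_map_poly o_def)
  ultimately have "has_degree (rpoly g a) m"
    unfolding has_degree_def using not_le by blast
  thus ?thesis by (simp add: g)
qed

end

section \<open>The gap between consecutive factorials\<close>

text \<open>
  The number \<open>H\<close> stands for the height of an approximation that is closer than \<open>H ^ -w\<close>.  Take \<open>N\<close>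
  least such that the second inequality holds with a margin.  Its failure at \<open>N - 1\<close> bounds
  \<open>x ^ N!\<close> by a multiple of \<open>H ^ E * b ^ (K * (N - 1)!)\<close>.  For large \<open>N\<close> the last factor is at most
  the square root of \<open>x ^ N!\<close>, so \<open>x ^ N!\<close>, and with it \<open>b ^ (K * N!)\<close>, is bounded by a fixed power
  of \<open>H\<close>; this is the first inequality.  If \<open>N\<close> is the smallest admissible index, no previous failure
  is available, but then \<open>x ^ N!\<close> is a constant.
\<close>

lemma factorial_gap:
  fixes x b c :: real and K E N0 :: nat
  assumes "x > 1" "b \<ge> 1" "c > 0"
  shows "\<exists>w H0. \<forall>H\<ge>H0. \<exists>N\<ge>N0. b ^ (K * fact N) * H ^ E < c * H ^ w
                              \<and> b ^ (K * fact N) * H ^ E < c * x ^ fact (Suc N)"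
proof -
  obtain \<mu> where \<mu>: "b ^ K < x ^ \<mu>" using real_arch_pow[OF assms(1)] by blast
  define A where "A = max 1 (1 / c)"
  have A: "A \<ge> 1" "1 \<le> c * A" using assms(3) by (auto simp: A_def max_def field_simps)
  \<comment> \<open>From \<open>N1\<close> on, \<open>2 * \<mu> * N!\<close> is at most \<open>(N + 1)!\<close>, which is what the squaring below exploits.\<close>
  define N1 where "N1 = max N0 (2 * \<mu>)"
  define w where "w = E + 2 * \<mu> * E + 1"
  define H0 where "H0 = 1 + A ^ (2 * \<mu> + 1) + A * x ^ (\<mu> * fact N1)"
  have bx: "b ^ (K * fact N) \<le> x ^ (\<mu> * fact N)" for N
    using \<mu> assms(2) by (simp add: power_mult power_mono)
  have "\<exists>N\<ge>N0. b ^ (K * fact N) * H ^ E < c * H ^ w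
                              \<and> b ^ (K * fact N) * H ^ E < c * x ^ fact (Suc N)" if H: "H \<ge> H0" for H
  proof -
    have "0 \<le> A ^ (2 * \<mu> + 1)" "0 \<le> A * x ^ (\<mu> * fact N1)" using A assms(1) by auto
    hence H1: "H \<ge> 1" "H > A ^ (2 * \<mu> + 1)" "H > A * x ^ (\<mu> * fact N1)"
      using H unfolding H0_def by linarith+
    define G where "G = (\<lambda>N. N \<ge> N1 \<and> A * H ^ E * x ^ (\<mu> * fact N) < x ^ fact (Suc N))"
    have "\<exists>N. G N"
    proof -
      obtain t where t: "A * H ^ E < x ^ t" using real_arch_pow[OF assms(1)] by blast
      define N where "N = N1 + \<mu> + t"
      have "A * H ^ E * x ^ (\<mu> * fact N) < x ^ t * x ^ (\<mu> * fact N)"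
        using t assms(1) by (intro mult_strict_right_mono) auto
      also have "\<dots> = x ^ (t + \<mu> * fact N)" by (simp add: power_add)
      also have "\<dots> \<le> x ^ fact (Suc N)"
      proof (intro power_increasing)
        have "t * 1 + \<mu> * fact N \<le> t * fact N + \<mu> * fact N"
          using fact_ge_1[of N, where ?'a = nat] by (intro add_mono mult_left_mono) auto
        also have "\<dots> = (t + \<mu>) * fact N" by (simp add: algebra_simps)
        also have "\<dots> \<le> Suc N * fact N" unfolding N_def by (intro mult_right_mono) auto
        finally show "t + \<mu> * fact N \<le> fact (Suc N)" by simp
      qed (use assms(1) in auto)
      finally show ?thesis unfolding G_def N_def by (intro exI[of _ "N1 + \<mu> + t"]) auto
    qed
    define N where "N = (LEAST N. G N)"
    have GN: "G N" unfolding N_def using \<open>\<exists>N. G N\<close> by (rule LeastI_ex)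
    have xN: "A * x ^ (\<mu> * fact N) * H ^ E < H ^ w"
    proof (cases "N = N1")
      case True
      have "A * x ^ (\<mu> * fact N) * H ^ E < H * H ^ E"
        using H1 True by (intro mult_strict_right_mono) auto
      also have "\<dots> = H ^ (E + 1)" by simp
      also have "\<dots> \<le> H ^ w" unfolding w_def using H1 by (intro power_increasing) auto
      finally show ?thesis .
    next
      case False
      hence "N > N1" using GN by (auto simp: G_def)
      then obtain M where M: "N = Suc M" "M \<ge> N1" by (cases N) auto
      have "\<not>G M" unfolding N_def using M(1) by (intro not_less_Least) (simp flip: N_def)
      hence le: "x ^ fact N \<le> A * H ^ E * x ^ (\<mu> * fact M)" using M by (auto simp: G_def)
      have "2 * (\<mu> * fact M) \<le> Suc M * fact M"
        using M(2) unfolding mult.assoc[symmetric] N1_def by (intro mult_right_mono) auto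
      hence fM: "2 * (\<mu> * fact M) \<le> fact N" using M(1) by simp
      have "(x ^ fact N)\<^sup>2 \<le> (A * H ^ E * x ^ (\<mu> * fact M))\<^sup>2"
        using le assms(1) by (intro power_mono) auto
      also have "\<dots> = A\<^sup>2 * H ^ (2 * E) * x ^ (2 * (\<mu> * fact M))"
        by (simp add: power_mult_distrib mult.commute flip: power_mult)
      also have "\<dots> \<le> A\<^sup>2 * H ^ (2 * E) * x ^ fact N"
        using fM assms(1) H1 by (intro mult_left_mono power_increasing) auto
      finally have "x ^ fact N \<le> A\<^sup>2 * H ^ (2 * E)"
        using assms(1) by (simp add: power2_eq_square[of "x ^ fact N"])
      hence "(x ^ fact N) ^ \<mu> \<le> (A\<^sup>2 * H ^ (2 * E)) ^ \<mu>"
        using assms(1) by (intro power_mono) auto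
      hence "x ^ (\<mu> * fact N) \<le> A ^ (2 * \<mu>) * H ^ (2 * \<mu> * E)"
        by (simp add: power_mult_distrib mult_ac flip: power_mult)
      hence "A * x ^ (\<mu> * fact N) * H ^ E \<le> A * (A ^ (2 * \<mu>) * H ^ (2 * \<mu> * E)) * H ^ E"
        using A H1 by (intro mult_right_mono mult_left_mono) auto
      also have "\<dots> = A ^ (2 * \<mu> + 1) * H ^ (E + 2 * \<mu> * E)"
        by (simp add: power_add mult_ac)
      also have "\<dots> < H * H ^ (E + 2 * \<mu> * E)"
        using H1 by (intro mult_strict_right_mono) auto
      also have "\<dots> = H ^ w" by (simp add: w_def)
      finally show ?thesis .
    qed
    have le: "b ^ (K * fact N) * H ^ E \<le> x ^ (\<mu> * fact N) * H ^ E"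
      using bx H1 by (intro mult_right_mono) auto
    have scale: "b ^ (K * fact N) * H ^ E < c * Z"
      if "A * (x ^ (\<mu> * fact N) * H ^ E) < Z" for Z
    proof -
      have "0 \<le> x ^ (\<mu> * fact N) * H ^ E" using assms(1) H1 by auto
      hence "1 * (x ^ (\<mu> * fact N) * H ^ E) \<le> (c * A) * (x ^ (\<mu> * fact N) * H ^ E)"
        using A by (intro mult_right_mono) auto
      also have "\<dots> = c * (A * (x ^ (\<mu> * fact N) * H ^ E))" by simp
      also have "\<dots> < c * Z" using that assms(3) by (intro mult_strict_left_mono)
      finally show ?thesis using le by linarith
    qed
    have "N \<ge> N0" using GN by (simp add: G_def N1_def)
    moreover have "b ^ (K * fact N) * H ^ E < c * H ^ w"
      using xN by (intro scale) (simp add: mult_ac)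
    moreover have "b ^ (K * fact N) * H ^ E < c * x ^ fact (Suc N)"
      using GN by (intro scale) (simp add: G_def mult_ac)
    ultimately show ?thesis by blast
  qed
  thus ?thesis by blast
qed

lemma factorial_gap_frequently:
  fixes x b c :: real and K N0 :: nat
  assumes "x > 1" "b \<ge> 1" "c > 0"
  shows "\<exists>N\<ge>N0. b ^ (K * fact N) < c * x ^ fact (Suc N)"
  using factorial_gap[OF assms, of N0 K 0] by auto

section \<open>The partial sums of the series\<close>

lemma factorial_add_le: "fact (Suc N) + i \<le> (fact (Suc (i + N)) :: nat)"
proof (induction i)
  case (Suc i)
  have "fact (Suc (i + N)) + 1 \<le> fact (Suc (i + N)) + Suc (i + N) * fact (Suc (i + N))"
    using fact_ge_1[of "Suc (i + N)", where ?'a = nat]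
    by (intro add_left_mono) (metis One_nat_def Suc_le_eq fact_gt_zero nat_0_less_mult_iff zero_less_Suc)
  also have "\<dots> = fact (Suc (Suc i + N))" by simp
  finally show ?case using Suc by linarith
qed simp

locale radical_series = radical +
  fixes a :: complex
  assumes a: "a ^ m = of_rat \<alpha>" and \<alpha>_less_1: "\<alpha> < 1"
begin

definition \<xi> where "\<xi> = factorial_series a"

definition \<beta> :: "nat \<Rightarrow> complex" where "\<beta> N = (\<Sum>n<N. a ^ fact (Suc n))"

definition \<rho> where "\<rho> = norm a"

definition den :: int where "den = snd (quotient_of \<alpha>)"

lemma den_pos: "den > 0"
  unfolding den_def using quotient_of_denom_pos' .

lemma \<alpha>_eq: "of_rat \<alpha> = (of_int (fst (quotient_of \<alpha>)) / of_int den :: complex)"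
proof -
  have "\<alpha> = of_int (fst (quotient_of \<alpha>)) / of_int den"
    unfolding den_def by (rule quotient_of_div) simp
  thus ?thesis by (metis of_rat_divide of_rat_of_int_eq)
qed

lemma \<rho>: "0 < \<rho>" "\<rho> < 1"
proof -
  have "\<rho> ^ m = of_rat \<alpha>"
    using arg_cong[OF a, of norm] \<alpha>_pos by (simp add: \<rho>_def norm_power norm_of_rat)
  hence "0 < \<rho> ^ m" "\<rho> ^ m < 1" using \<alpha>_pos \<alpha>_less_1 by auto
  show "0 < \<rho>"
  proof (rule ccontr)
    assume "\<not>0 < \<rho>"
    hence "\<rho> = 0" using norm_ge_zero[of a] unfolding \<rho>_def by linarith
    thus False using \<open>0 < \<rho> ^ m\<close> m_pos by (simp add: power_0_left)
  qed
  show "\<rho> < 1"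
  proof (rule ccontr)
    assume "\<not>\<rho> < 1"
    hence "1 \<le> \<rho> ^ m" by (intro one_le_power) simp
    thus False using \<open>\<rho> ^ m < 1\<close> by simp
  qed
qed

lemma norm_tail: "norm (\<xi> - \<beta> N) \<le> \<rho> ^ fact (Suc N) / (1 - \<rho>)"
proof -
  have bound: "norm (a ^ fact (Suc (i + M))) \<le> \<rho> ^ fact (Suc M) * \<rho> ^ i" for i M
    using \<rho> factorial_add_le[of M i]
    by (simp add: norm_power \<rho>_def[symmetric] power_decreasing flip: power_add)
  have geo: "summable (\<lambda>i. \<rho> ^ fact (Suc M) * \<rho> ^ i)" for M
    using \<rho> by (intro summable_mult summable_geometric) auto
  have summ: "summable (\<lambda>i. a ^ fact (Suc (i + M)))" for M
    using bound by (intro summable_comparison_test'[OF geo[of M], of 0]) auto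
  have "\<xi> = (\<Sum>i. a ^ fact (Suc (i + N))) + \<beta> N"
    unfolding \<xi>_def factorial_series_def \<beta>_def
    using suminf_split_initial_segment[of "\<lambda>n. a ^ fact (Suc n)" N] summ[of 0] by simp
  hence "norm (\<xi> - \<beta> N) = norm (\<Sum>i. a ^ fact (Suc (i + N)))" by simp
  also have "\<dots> \<le> (\<Sum>i. \<rho> ^ fact (Suc N) * \<rho> ^ i)"
    using bound geo by (intro norm_suminf_le) auto
  also have "\<dots> = \<rho> ^ fact (Suc N) / (1 - \<rho>)"
    using \<rho> by (subst suminf_mult) (auto simp: suminf_geometric summable_geometric)
  finally show ?thesis .
qed

text \<open>
  A bound for the moduli of all partial sums and of all points at distance at most \<open>1\<close> from \<open>\<xi>\<close>.
\<close>

definition T where "T = norm \<xi> + 1 + 1 / (1 - \<rho>)"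

lemma T: "T \<ge> 1" "norm \<xi> + 1 \<le> T" "norm (\<beta> N) \<le> T"
proof -
  show "norm \<xi> + 1 \<le> T" "T \<ge> 1" using \<rho> by (auto simp: T_def)
  have "norm (\<beta> N) \<le> norm \<xi> + norm (\<xi> - \<beta> N)"
    using norm_triangle_ineq4[of \<xi> "\<xi> - \<beta> N"] by simp
  moreover have "\<rho> ^ fact (Suc N) / (1 - \<rho>) \<le> 1 / (1 - \<rho>)"
    using \<rho> by (intro divide_right_mono power_le_one) auto
  ultimately show "norm (\<beta> N) \<le> T" using norm_tail[of N] by (simp add: T_def)
qed

lemma \<beta>_eq_shift:
  assumes "N \<ge> m"
  shows "\<exists>u. \<beta> N = \<beta> m + of_int u / of_int (den ^ fact N)"
  using assms
proof (induction N rule: dec_induct)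
  case base
  show ?case by (intro exI[of _ 0]) simp
next
  case (step N)
  define p where "p = fst (quotient_of \<alpha>)"
  obtain u where u: "\<beta> N = \<beta> m + of_int u / of_int (den ^ fact N)" using step by auto
  have "m dvd fact (Suc N)" using step m_pos by (intro dvd_fact) auto
  then obtain t where t: "fact (Suc N) = m * t" by auto
  define n :: nat where "n = fact (Suc N)"
  have tn: "t \<le> n" using t m_pos by (simp add: n_def)
  have Nn: "fact N \<le> n" unfolding n_def by (intro fact_mono) auto
  have d0: "(of_int den :: complex) \<noteq> 0" using den_pos by simp
  have split: "(of_int den :: complex) ^ n = of_int den ^ k * of_int den ^ (n - k)" if "k \<le> n" for k
    using that by (simp flip: power_add)
  have "a ^ fact (Suc N) = (of_int p / of_int den) ^ t"
    by (simp only: t power_mult a \<alpha>_eq p_def)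
  also have "\<dots> = of_int (p ^ t * den ^ (n - t)) / of_int den ^ n"
    using d0 by (simp add: power_divide split[OF tn])
  finally have 1: "a ^ fact (Suc N) = of_int (p ^ t * den ^ (n - t)) / of_int den ^ n" .
  have 2: "of_int u / of_int (den ^ fact N) = (of_int (u * den ^ (n - fact N)) / of_int den ^ n :: complex)"
    using d0 by (simp add: split[OF Nn])
  have "\<beta> (Suc N) = \<beta> N + a ^ fact (Suc N)" unfolding \<beta>_def by simp
  also have "\<dots> = \<beta> m + of_int (u * den ^ (n - fact N) + p ^ t * den ^ (n - t)) / of_int (den ^ n)"
    unfolding 1 u 2 by (simp add: add_divide_distrib)
  finally show ?case unfolding n_def by blast
qed

lemma has_degree_\<beta>:
  assumes "N \<ge> m"
  shows "has_degree (\<beta> N) m"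
proof -
  have "has_degree (\<beta> m) m" unfolding \<beta>_def using a by (rule has_degree_factorial_sum)
  thus ?thesis using \<beta>_eq_shift[OF assms] has_degree_shift den_pos
    by (metis zero_less_power)
qed

lemma \<beta>_shift_bounded:
  assumes "N \<ge> m"
  obtains s u :: int where "s > 0" "s = den ^ fact N" "\<beta> N = \<beta> m + of_int u / of_int s"
    "of_int (s + \<bar>u\<bar>) \<le> (1 + 2 * T) * real_of_int s"
proof -
  define s where "s = den ^ fact N"
  have s: "s > 0" using den_pos by (simp add: s_def)
  obtain u where u: "\<beta> N = \<beta> m + of_int u / of_int s" using \<beta>_eq_shift[OF assms] s_def by auto
  hence "norm (of_int u / of_int s :: complex) = norm (\<beta> N - \<beta> m)" by simp
  also have "\<dots> \<le> 2 * T" using norm_triangle_ineq4[of "\<beta> N" "\<beta> m"] T(3)[of N] T(3)[of m] by linarith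
  finally have "of_int \<bar>u\<bar> \<le> 2 * T * real_of_int s"
    using s by (simp add: norm_divide field_simps)
  thus ?thesis using that[OF s s_def u] by (simp add: algebra_simps)
qed

text \<open>
  From the index \<open>m\<close> on, the summands are positive rational numbers.
\<close>

lemma inj_\<beta>: "inj_on \<beta> {m..}"
proof -
  have "\<beta> N \<noteq> \<beta> M" if "m \<le> N" "N < M" for N M
  proof -
    have pow: "\<exists>q>0. a ^ fact (Suc n) = of_rat q" if "n \<ge> m" for n
    proof -
      have "m dvd fact (Suc n)" using that m_pos by (intro dvd_fact) auto
      then obtain t where "fact (Suc n) = m * t" by auto
      hence "a ^ fact (Suc n) = of_rat (\<alpha> ^ t)" by (simp only: power_mult a of_rat_power)
      thus ?thesis using \<alpha>_pos by (meson zero_less_power)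
    qed
    have "Re (a ^ fact (Suc n)) > 0" if "n \<ge> m" for n
    proof -
      obtain q where "q > 0" "a ^ fact (Suc n) = of_rat q" using pow \<open>n \<ge> m\<close> by blast
      thus ?thesis by (simp flip: of_real_of_rat)
    qed
    hence "(\<Sum>n\<in>{N..<M}. Re (a ^ fact (Suc n))) > 0"
      using that by (intro sum_pos) auto
    moreover have "\<beta> M = \<beta> N + (\<Sum>n\<in>{N..<M}. a ^ fact (Suc n))"
      unfolding \<beta>_def lessThan_atLeast0 using that by (simp add: sum.atLeastLessThan_concat)
    ultimately have "Re (\<beta> M) > Re (\<beta> N)" by simp
    thus ?thesis by auto
  qed
  thus ?thesis by (intro inj_onI) (metis atLeast_iff linorder_neqE_nat)
qed

text \<open>
  The Liouville inequality at the fixed number \<open>\<beta> m\<close>, applied to translates of \<open>M\<close>, gives a bound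
  at \<open>\<beta> N\<close> that is uniform in \<open>N\<close> apart from the explicit power of the denominator.
\<close>

lemma lower_bound_at_\<beta>:
  "\<exists>c>0. \<exists>e. \<forall>N\<ge>m. \<forall>M. degree M \<le> D \<and> ipoly M (\<beta> N) \<noteq> 0 \<longrightarrow>
     c \<le> norm (ipoly M (\<beta> N)) * of_int (poly_length M) ^ e * of_int den ^ (D * Suc e * fact N)"
proof -
  obtain c e where c: "c > 0" and ce: "\<And>Q. degree Q \<le> D \<Longrightarrow> ipoly Q (\<beta> m) \<noteq> 0 \<Longrightarrow>
       c \<le> norm (ipoly Q (\<beta> m)) * of_int (poly_length Q) ^ e"
    using Liouville_ineq[OF has_degree_\<beta>[OF order_refl], of D] by blast
  define C where "C = 1 + 2 * T"
  have C: "C > 0" using T(1) by (simp add: C_def)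
  have "c / C ^ (D * e) \<le> norm (ipoly M (\<beta> N)) * of_int (poly_length M) ^ e * of_int den ^ (D * Suc e * fact N)"
    if N: "N \<ge> m" and M: "degree M \<le> D" "ipoly M (\<beta> N) \<noteq> 0" for N M
  proof -
    obtain s u where su: "s > 0" "s = den ^ fact N" "\<beta> N = \<beta> m + of_int u / of_int s"
       "of_int (s + \<bar>u\<bar>) \<le> C * real_of_int s" unfolding C_def using \<beta>_shift_bounded[OF N] by blast
    obtain Q where Q: "degree Q \<le> D" "poly_length Q \<le> poly_length M * (s + \<bar>u\<bar>) ^ D"
      "\<And>x. ipoly Q x = of_int s ^ D * ipoly M (x + of_int u / of_int s)"
      using ipoly_shift[OF M(1) su(1)] by blast
    have Qm: "ipoly Q (\<beta> m) = of_int s ^ D * ipoly M (\<beta> N)" by (simp add: Q(3) su(3))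
    have "real_of_int (poly_length Q) \<le> of_int (poly_length M) * of_int (s + \<bar>u\<bar>) ^ D"
      using Q(2) by (metis of_int_le_iff of_int_mult of_int_power)
    also have "\<dots> \<le> of_int (poly_length M) * (C * of_int s) ^ D"
      using su(1,4) by (intro mult_left_mono power_mono) auto
    finally have lenQ: "real_of_int (poly_length Q) \<le> of_int (poly_length M) * (C * of_int s) ^ D" .
    have "c \<le> norm (ipoly Q (\<beta> m)) * of_int (poly_length Q) ^ e"
      using Q(1) Qm M(2) su(1) by (intro ce) auto
    also have "\<dots> \<le> norm (ipoly Q (\<beta> m)) * (of_int (poly_length M) * (C * of_int s) ^ D) ^ e"
      using lenQ by (intro mult_left_mono power_mono) auto
    also have "\<dots> = C ^ (D * e) * (norm (ipoly M (\<beta> N)) * of_int (poly_length M) ^ e * of_int s ^ (D * Suc e))"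
      using su(1) unfolding Qm
      by (simp add: norm_mult norm_power power_mult_distrib power_add mult_ac flip: power_mult)
    also have "real_of_int s ^ (D * Suc e) = of_int den ^ (D * Suc e * fact N)"
      unfolding su(2) by (simp add: mult.commute flip: power_mult)
    finally show ?thesis using C by (simp add: field_simps)
  qed
  thus ?thesis using c C by (intro exI[of _ "c / C ^ (D * e)"]) auto
qed

lemma inverse_\<rho>: "1 / \<rho> > 1" "\<rho> ^ n = 1 / (1 / \<rho>) ^ n"
  using \<rho> by (auto simp: power_one_over)

lemma den_ge_1: "real_of_int den \<ge> 1"
  using den_pos by simp

section \<open>Transcendence and approximability of the series\<close>

text \<open>
  A nonzero integer polynomial with root \<open>\<xi>\<close> would be at most a constant times \<open>\<rho> ^ (N + 1)!\<close> at \<open>\<beta> N\<close>.  For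
  large \<open>N\<close> its values there are nonzero, because the \<open>\<beta> N\<close> are distinct, and this contradicts \<open>lower_bound_at_\<beta>\<close>.
\<close>

lemma not_algebraic_\<xi>: "\<not>algebraic \<xi>"
proof
  assume "algebraic \<xi>"
  then obtain M where M: "M \<noteq> 0" "ipoly M \<xi> = 0" by (auto elim: algebraicE')
  define D where "D = degree M"
  obtain c e where c: "c > 0" and ce: "\<And>N. N \<ge> m \<Longrightarrow> ipoly M (\<beta> N) \<noteq> 0 \<Longrightarrow>
     c \<le> norm (ipoly M (\<beta> N)) * of_int (poly_length M) ^ e * of_int den ^ (D * Suc e * fact N)"
    using lower_bound_at_\<beta>[of D] D_def by blast
  have "finite {x. ipoly M x = 0}"
    using M by (intro poly_roots_finite) (auto simp: map_poly_eq_0_iff)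
  hence "finite (\<beta> -` {x. ipoly M x = 0} \<inter> {m..})"
    using inj_\<beta> by (intro finite_vimage_IntI)
  then obtain N1 where "\<forall>N\<in>\<beta> -` {x. ipoly M x = 0} \<inter> {m..}. N \<le> N1"
    using finite_nat_set_iff_bounded_le by auto
  hence N1: "ipoly M (\<beta> N) \<noteq> 0" if "N \<ge> max m (Suc N1)" for N using that by force
  define L where "L = real_of_int (poly_length M)"
  have L: "L \<ge> 1" using poly_length_ge_1[OF M(1)] by (simp add: L_def)
  \<comment> \<open>The summand \<open>1\<close> makes \<open>C\<close> positive without a separate argument that \<open>D > 0\<close>.\<close>
  define C where "C = L * (real D * T ^ D) / (1 - \<rho>) * L ^ e + 1"
  have C: "C \<ge> 1" using L T(1) \<rho> by (simp add: C_def)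
  have "0 < c / C" using c C by simp
  then obtain N where N: "N \<ge> max m (Suc N1)"
    "real_of_int den ^ (D * Suc e * fact N) < c / C * (1 / \<rho>) ^ fact (Suc N)"
    using factorial_gap_frequently[OF inverse_\<rho>(1) den_ge_1, of "c / C" "max m (Suc N1)"] by blast
  have "norm (ipoly M (\<beta> N)) = norm (ipoly M (\<beta> N) - ipoly M \<xi>)" using M by simp
  also have "\<dots> \<le> L * (real D * T ^ D) * norm (\<beta> N - \<xi>)"
    unfolding L_def using T by (intro norm_ipoly_diff_le) (auto simp: D_def intro: order.trans[OF _ T(2)])
  also have "\<dots> \<le> L * (real D * T ^ D) * (\<rho> ^ fact (Suc N) / (1 - \<rho>))"
    using norm_tail[of N] L T(1) by (intro mult_left_mono) (auto simp: norm_minus_commute)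
  finally have "norm (ipoly M (\<beta> N)) * L ^ e \<le> L * (real D * T ^ D) * (\<rho> ^ fact (Suc N) / (1 - \<rho>)) * L ^ e"
    using L by (intro mult_right_mono) auto
  also have "\<dots> = (L * (real D * T ^ D) / (1 - \<rho>) * L ^ e) * \<rho> ^ fact (Suc N)"
    by simp
  also have "\<dots> \<le> C * \<rho> ^ fact (Suc N)"
    using \<rho> by (intro mult_right_mono) (auto simp: C_def)
  finally have "norm (ipoly M (\<beta> N)) * L ^ e * of_int den ^ (D * Suc e * fact N)
       \<le> C * \<rho> ^ fact (Suc N) * of_int den ^ (D * Suc e * fact N)"
    using den_pos by (intro mult_right_mono) auto
  hence "c \<le> C * \<rho> ^ fact (Suc N) * of_int den ^ (D * Suc e * fact N)"
    using ce[of N] N1[of N] N(1) unfolding L_def by force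
  also have "\<dots> < C * \<rho> ^ fact (Suc N) * (c / C * (1 / \<rho>) ^ fact (Suc N))"
    using N(2) C \<rho> by (intro mult_strict_left_mono) auto
  also have "\<dots> = c" using C \<rho> by (simp add: power_one_over)
  finally show False by simp
qed

text \<open>
  The minimal polynomial of \<open>\<beta> N\<close> divides one obtained from the fixed polynomial \<open>F\<close> of \<open>\<beta> m\<close> by translation,
  so the height of \<open>\<beta> N\<close> is at most \<open>C * den ^ (m * N!)\<close>.
\<close>

lemma well_approximable_\<xi>: "well_approximable m \<xi>"
  unfolding well_approximable_def
proof (intro allI impI)
  fix w :: real assume "w > 0"
  obtain W :: nat where W: "w \<le> real W" using real_arch_simple by blast
  obtain F where F: "F \<noteq> 0" "degree F = m" "ipoly F (\<beta> m) = 0"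
    using has_degree_\<beta>[OF order_refl] unfolding has_degree_def by auto
  define C where "C = of_int (poly_length F) * (1 + 2 * T) ^ m"
  have C: "C > 0" unfolding C_def using poly_length_ge_1[OF F(1)] T(1) by (intro mult_pos_pos) auto
  define S where "S = {N. N \<ge> m \<and> real_of_int den ^ (m * W * fact N) < (1 - \<rho>) / C ^ W * (1 / \<rho>) ^ fact (Suc N)}"
  have "infinite S"
  proof (unfold infinite_nat_iff_unbounded_le, intro allI)
    fix N0
    have "0 < (1 - \<rho>) / C ^ W" using C \<rho> by simp
    from factorial_gap_frequently[OF inverse_\<rho>(1) den_ge_1 this, of "max m N0" "m * W"]
    show "\<exists>N\<ge>N0. N \<in> S" unfolding S_def by auto
  qed
  moreover have "inj_on \<beta> S" using inj_\<beta> by (rule inj_on_subset) (auto simp: S_def)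
  ultimately have "infinite (\<beta> ` S)" using finite_imageD by blast
  moreover have "\<beta> ` S \<subseteq> {\<beta>. algebraic \<beta> \<and> alg_degree \<beta> = m \<and>
           norm (\<xi> - \<beta>) < real_of_int (poly_height (int_min_poly \<beta>)) powr (- w)}"
  proof safe
    fix N assume NS: "N \<in> S"
    hence N: "N \<ge> m" by (simp add: S_def)
    note deg = has_degree_\<beta>[OF N]
    show alg: "algebraic (\<beta> N)" using has_degree_imp_algebraic[OF deg] .
    show "alg_degree (\<beta> N) = m" using alg_degree_eq[OF deg] .
    define H where "H = real_of_int (poly_height (int_min_poly (\<beta> N)))"
    have "int_min_poly (\<beta> N) \<noteq> 0" using int_min_poly(1)[OF alg] by auto
    hence H1: "H \<ge> 1" using height_ge_1 by (simp add: H_def)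
    obtain s u where su: "s > 0" "s = den ^ fact N" "\<beta> N = \<beta> m + of_int u / of_int s"
       "of_int (s + \<bar>u\<bar>) \<le> (1 + 2 * T) * real_of_int s" using \<beta>_shift_bounded[OF N] by blast
    obtain G where G: "G \<noteq> 0" "degree G \<le> m" "poly_length G \<le> poly_length F * (s + \<bar>-u\<bar>) ^ m"
      "\<And>x. ipoly G x = of_int s ^ m * ipoly F (x + of_int (-u) / of_int s)"
      using ipoly_shift_nonzero[of F m s "-u"] F(1,2) su(1) by (metis order_refl)
    have "ipoly G (\<beta> N) = 0" using G(4)[of "\<beta> N"] F(3) su(3) by simp
    hence "poly_height (int_min_poly (\<beta> N)) \<le> poly_length F * (s + \<bar>u\<bar>) ^ m"
      using height_int_min_poly_le[OF deg G(1) _ G(2)] G(3) by simp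
    hence "H \<le> of_int (poly_length F) * of_int (s + \<bar>u\<bar>) ^ m"
      unfolding H_def by (metis of_int_le_iff of_int_mult of_int_power)
    also have "\<dots> \<le> of_int (poly_length F) * ((1 + 2 * T) * of_int s) ^ m"
      using su(1,4) by (intro mult_left_mono power_mono) auto
    also have "\<dots> = C * of_int den ^ (m * fact N)"
      by (simp add: C_def su(2) power_mult_distrib mult_ac flip: power_mult)
    finally have "H ^ W \<le> (C * of_int den ^ (m * fact N)) ^ W"
      using H1 by (intro power_mono) auto
    also have "\<dots> = C ^ W * of_int den ^ (m * W * fact N)"
      by (simp add: power_mult_distrib mult_ac flip: power_mult)
    also have "\<dots> < C ^ W * ((1 - \<rho>) / C ^ W * (1 / \<rho>) ^ fact (Suc N))"
      using NS C unfolding S_def by (intro mult_strict_left_mono) auto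
    also have "\<dots> = (1 - \<rho>) / \<rho> ^ fact (Suc N)"
      using C by (simp add: power_one_over)
    finally have "\<rho> ^ fact (Suc N) / (1 - \<rho>) < 1 / H ^ W"
      using \<rho> H1 by (simp add: field_simps)
    also have "1 / H ^ W = H powr (- real W)"
      using H1 by (simp add: powr_minus powr_realpow divide_inverse)
    also have "\<dots> \<le> H powr (- w)" using H1 W by (intro powr_mono) auto
    finally show "norm (\<xi> - \<beta> N) < H powr (- w)" using norm_tail[of N] by linarith
  qed
  ultimately show "infinite {\<beta>. algebraic \<beta> \<and> alg_degree \<beta> = m \<and>
           norm (\<xi> - \<beta>) < real_of_int (poly_height (int_min_poly \<beta>)) powr (- w)}"
    using finite_subset by blast
qed

text \<open>
  By \<open>finite_bounded_height\<close> the approximations \<open>z\<close> of degree \<open>k\<close> would have unbounded height \<open>H\<close>.  The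
  minimal polynomial \<open>M\<close> of \<open>z\<close> does not vanish at \<open>\<beta> N\<close>, which has degree \<open>m > k\<close>, so \<open>lower_bound_at_\<beta>\<close>
  applies, while \<open>M(\<beta> N)\<close> is at most \<open>H\<close> times the distance of \<open>\<beta> N\<close> and \<open>z\<close>, up to a constant.
  That distance is controlled by the distances of both numbers to \<open>\<xi>\<close>, and \<open>factorial_gap\<close> provides
  an \<open>N\<close> for which both are too small.
\<close>

lemma not_well_approximable_\<xi>:
  assumes k: "0 < k" "k < m"
  shows "\<not>well_approximable k \<xi>"
proof
  assume wa: "well_approximable k \<xi>"
  obtain c e where c: "c > 0" and ce: "\<And>N M. N \<ge> m \<Longrightarrow> degree M \<le> k \<Longrightarrow> ipoly M (\<beta> N) \<noteq> 0 \<Longrightarrow>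
     c \<le> norm (ipoly M (\<beta> N)) * of_int (poly_length M) ^ e * of_int den ^ (k * Suc e * fact N)"
    using lower_bound_at_\<beta>[of k] by blast
  define C where "C = real (Suc k) ^ Suc e * (real k * T ^ k) / (1 - \<rho>)"
  have C: "C > 0" using T(1) \<rho> k unfolding C_def by (intro divide_pos_pos mult_pos_pos) auto
  define c' where "c' = c / (2 * C)"
  have c': "c' > 0" using c C by (simp add: c'_def)
  obtain w H0 where gap: "\<And>H. H \<ge> H0 \<Longrightarrow> \<exists>N\<ge>m.
       real_of_int den ^ (k * Suc e * fact N) * H ^ Suc e < c' * H ^ w \<and>
       real_of_int den ^ (k * Suc e * fact N) * H ^ Suc e < c' * (1 / \<rho>) ^ fact (Suc N)"
    using factorial_gap[OF inverse_\<rho>(1) den_ge_1 c', of m "k * Suc e" "Suc e"] by blast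
  \<comment> \<open>A positive exponent is required, and \<open>w\<close> may be zero.\<close>
  define W where "W = Suc w"
  define S where "S = {\<beta>. algebraic \<beta> \<and> alg_degree \<beta> = k \<and>
           norm (\<xi> - \<beta>) < real_of_int (poly_height (int_min_poly \<beta>)) powr (- real W)}"
  have "real W > 0" by (simp add: W_def)
  hence "infinite S" using wa unfolding well_approximable_def S_def by blast
  hence "\<not>S \<subseteq> {x. algebraic x \<and> alg_degree x = k \<and> real_of_int (poly_height (int_min_poly x)) \<le> H0}"
    using finite_bounded_height finite_subset by blast
  then obtain z where z: "algebraic z" "alg_degree z = k" "real_of_int (poly_height (int_min_poly z)) > H0"
    "norm (\<xi> - z) < real_of_int (poly_height (int_min_poly z)) powr (- real W)"
    unfolding S_def by force
  define M where "M = int_min_poly z"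
  define H where "H = real_of_int (poly_height M)"
  have M: "irreducible M" "ipoly M z = 0" "degree M = k"
    using int_min_poly[OF z(1)] degree_int_min_poly[OF z(1)] z(2) by (auto simp: M_def)
  have M0: "M \<noteq> 0" using M(1) by auto
  have H1: "H \<ge> 1" using height_ge_1[OF M0] by (simp add: H_def)
  have "norm (\<xi> - z) < H powr (- real W)" using z(4) by (simp add: H_def M_def)
  also have "\<dots> = 1 / H ^ W"
    using H1 by (simp add: powr_minus powr_realpow divide_inverse)
  also have "\<dots> \<le> 1 / H ^ w"
    using H1 unfolding W_def by (intro divide_left_mono power_increasing) auto
  finally have dz: "norm (\<xi> - z) < 1 / H ^ w" .
  have "1 / H ^ w \<le> 1" using H1 one_le_power[of H w] by (simp add: field_simps)
  hence nz: "norm z \<le> T"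
    using dz T(2) norm_triangle_ineq4[of \<xi> "\<xi> - z"] by simp
  obtain N where N: "N \<ge> m"
    "real_of_int den ^ (k * Suc e * fact N) * H ^ Suc e < c' * H ^ w"
    "real_of_int den ^ (k * Suc e * fact N) * H ^ Suc e < c' * (1 / \<rho>) ^ fact (Suc N)"
    using gap[of H] z(3) by (auto simp: H_def M_def)
  define X where "X = real_of_int den ^ (k * Suc e * fact N) * H ^ Suc e"
  have X0: "X \<ge> 0" using den_pos H1 by (simp add: X_def)
  define Y where "Y = \<rho> ^ fact (Suc N) + 1 / H ^ w"
  have Y0: "Y \<ge> 0" using \<rho> H1 by (simp add: Y_def)
  have "ipoly M (\<beta> N) \<noteq> 0" using has_degreeD[OF has_degree_\<beta>[OF N(1)] M0] M(3) k by auto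
  hence "c \<le> norm (ipoly M (\<beta> N)) * of_int (poly_length M) ^ e * of_int den ^ (k * Suc e * fact N)"
    using ce N(1) M(3) by blast
  also have "\<dots> \<le> (real (Suc k) * H * (real k * T ^ k) * (Y / (1 - \<rho>))) * (real (Suc k) * H) ^ e *
                        of_int den ^ (k * Suc e * fact N)"
  proof -
    have "real_of_int (poly_length M) \<le> of_int (int (Suc k) * poly_height M)"
      using poly_length_le_height[of M] M(3) by (simp only: of_int_le_iff)
    hence lenM: "real_of_int (poly_length M) \<le> real (Suc k) * H" by (simp add: H_def)
    have "norm (\<beta> N - z) \<le> norm (\<xi> - \<beta> N) + norm (\<xi> - z)"
      using norm_triangle_ineq4[of "\<xi> - z" "\<xi> - \<beta> N"] by simp
    also have "\<dots> \<le> \<rho> ^ fact (Suc N) / (1 - \<rho>) + 1 / H ^ w"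
      using norm_tail[of N] dz by linarith
    also have "\<dots> \<le> \<rho> ^ fact (Suc N) / (1 - \<rho>) + 1 / H ^ w / (1 - \<rho>)"
      using \<rho> H1 by (intro add_left_mono) (simp add: field_simps)
    finally have dist: "norm (\<beta> N - z) \<le> Y / (1 - \<rho>)" by (simp add: Y_def add_divide_distrib)
    have "norm (ipoly M (\<beta> N)) \<le> of_int (poly_length M) * (real k * T ^ k) * norm (\<beta> N - z)"
      using norm_ipoly_diff_le[of "\<beta> N" T z M k] T(1) T(3) nz M by simp
    also have "\<dots> \<le> real (Suc k) * H * (real k * T ^ k) * (Y / (1 - \<rho>))"
      using T(1) H1 by (intro mult_mono lenM dist order.refl) auto
    finally have "norm (ipoly M (\<beta> N)) \<le> real (Suc k) * H * (real k * T ^ k) * (Y / (1 - \<rho>))" .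
    moreover have "real_of_int (poly_length M) ^ e \<le> (real (Suc k) * H) ^ e"
      using lenM by (intro power_mono) auto
    moreover have "0 \<le> real (Suc k) * H * (real k * T ^ k) * (Y / (1 - \<rho>))"
      using T(1) H1 Y0 \<rho> by (intro mult_nonneg_nonneg divide_nonneg_pos) auto
    ultimately show ?thesis using den_pos
      by (intro mult_right_mono mult_mono) auto
  qed
  also have "\<dots> = C * (X * Y)"
    unfolding C_def X_def power_mult_distrib by simp
  also have "X * Y = X * \<rho> ^ fact (Suc N) + X / H ^ w"
    by (simp only: Y_def distrib_left) simp
  also have "C * (X * \<rho> ^ fact (Suc N) + X / H ^ w) < C * (c' + c')"
  proof (intro mult_strict_left_mono add_strict_mono C)
    show "X / H ^ w < c'" using N(2) H1 by (simp add: X_def pos_divide_less_eq)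
    show "X * \<rho> ^ fact (Suc N) < c'"
      using N(3) \<rho> by (simp add: X_def inverse_\<rho>(2)[of "fact (Suc N)"] pos_divide_less_eq del: fact_Suc)
  qed
  also have "C * (c' + c') = c" using C by (simp add: c'_def)
  finally show False by simp
qed

lemma factorial_series_in_U_class: "factorial_series a \<in> U_class m"
  using not_algebraic_\<xi> well_approximable_\<xi> not_well_approximable_\<xi> m_pos
  by (auto simp: U_class_def \<xi>_def)

end

lemma one_half_not_rat_power:
  assumes "p > 1"
  shows "(1 / 2 :: rat) \<noteq> q ^ p"
proof
  assume *: "(1 / 2 :: rat) = q ^ p"
  define x :: real where "x = of_rat (inverse q)"
  have "inverse q ^ p = 2" by (simp add: power_inverse flip: *)
  hence xp: "x ^ p = 2" by (simp add: x_def flip: of_rat_power)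
  have "algebraic_int x"
  proof (rule algebraic_int_root)
    show "poly (monom 1 p) x = 2" by (simp add: poly_monom xp)
  qed (use assms in \<open>simp_all add: degree_monom_eq\<close>)
  moreover have "x \<in> \<rat>" by (simp add: x_def)
  ultimately have "x \<in> \<int>" by (rule rational_algebraic_int_is_int)
  then obtain n where n: "x = of_int n" by (auto elim: Ints_cases)
  hence "of_int (n ^ p) = (of_int 2 :: real)" using xp by simp
  hence np: "n ^ p = 2" by (simp only: of_int_eq_iff)
  hence "\<bar>n\<bar> ^ p = 2" by (metis abs_numeral power_abs)
  show False
  proof (cases "\<bar>n\<bar> \<le> 1")
    case True
    hence "\<bar>n\<bar> ^ p \<le> 1" by (intro power_le_one) auto
    thus False using \<open>\<bar>n\<bar> ^ p = 2\<close> by simp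
  next
    case False
    hence "(2::int) ^ 2 \<le> \<bar>n\<bar> ^ 2" by (intro power_mono) auto
    also have "\<dots> \<le> \<bar>n\<bar> ^ p" using False assms by (intro power_increasing) auto
    finally show False using \<open>\<bar>n\<bar> ^ p = 2\<close> by simp
  qed
qed

theorem corollary1p4:
  fixes m :: nat
  assumes "m > 0"
  shows "(\<forall>(\<alpha>::rat) (a::complex).
            0 < \<alpha> \<and> \<alpha> < 1 \<and> a ^ m = of_rat \<alpha> \<and>
            (\<forall>p::nat. prime p \<and> p dvd m \<longrightarrow> \<not> (\<exists>q::rat. \<alpha> = q ^ p))
            \<longrightarrow> factorial_series a \<in> U_class m) \<and>
         factorial_series (complex_of_real (2 powr (- 1 / real m))) \<in> U_class m"
proof
  show main: "\<forall>(\<alpha>::rat) (a::complex).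
            0 < \<alpha> \<and> \<alpha> < 1 \<and> a ^ m = of_rat \<alpha> \<and>
            (\<forall>p::nat. prime p \<and> p dvd m \<longrightarrow> \<not> (\<exists>q::rat. \<alpha> = q ^ p))
            \<longrightarrow> factorial_series a \<in> U_class m"
  proof (intro allI impI, elim conjE)
    fix \<alpha> :: rat and a :: complex
    assume *: "0 < \<alpha>" "\<alpha> < 1" "a ^ m = of_rat \<alpha>"
      "\<forall>p::nat. prime p \<and> p dvd m \<longrightarrow> \<not> (\<exists>q::rat. \<alpha> = q ^ p)"
    interpret radical_series m \<alpha> a
      by unfold_locales (use assms * in auto)
    show "factorial_series a \<in> U_class m" by (rule factorial_series_in_U_class)
  qed
  have "(2 powr (- 1 / real m)) ^ m = ((2::real) powr (- 1 / real m)) powr real m"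
    by (rule powr_realpow [symmetric]) simp
  also have "\<dots> = 2 powr (- 1 / real m * real m)" by (rule powr_powr)
  also have "\<dots> = 1 / 2" using assms by (simp add: powr_minus_divide)
  finally have "(2 powr (- 1 / real m)) ^ m = (1 / 2 :: real)" .
  hence "complex_of_real (2 powr (- 1 / real m)) ^ m = complex_of_real (1 / 2)"
    by (metis of_real_power)
  hence "complex_of_real (2 powr (- 1 / real m)) ^ m = of_rat (1 / 2)"
    by (simp only: of_rat_divide) simp
  moreover have "\<forall>p::nat. prime p \<and> p dvd m \<longrightarrow> \<not> (\<exists>q::rat. 1 / 2 = q ^ p)"
    using one_half_not_rat_power prime_gt_1_nat by blast
  ultimately show "factorial_series (complex_of_real (2 powr (- 1 / real m))) \<in> U_class m"
    using main[rule_format, of "1 / 2"] by simp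
qed

end
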